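(* Let $m,n$ be positive integers with $\gcd(m,n)=1$ and let $\mathbb{H}_{m/n}=\{(z_1,z_2)\in\mathbb{C}^2:|z_1|^{m/n}<|z_2|<1\}$. Let $2\le p<\infty$ and $g\in L^p(\mathbb{H}_{m/n})$. The function $\widetilde{\mathbf{B}^p}g$, which is the $L^p$ sub-Bergman projection of $g$, satisfies $$\big\|g-\widetilde{\mathbf{B}^p}g\big\|_{L^2}\le\|g-h\|_{L^2}$$ for all $h\in A^p(\mathbb{H}_{m/n})$, with equality if and only if $h=\widetilde{\mathbf{B}^p}g$.
   Context: $A^p(\Omega)$ is the Bergman space of holomorphic functions on $\Omega$ lying in $L^p(\Omega)$ (Lebesgue measure). For a bounded domain $\Omega$ and $p\ge2$, let $G^{2,p}(\Omega)$ be the closure of $A^p(\Omega)$ in $A^2(\Omega)$ (with respect to the $L^2$ norm). The $L^p$ sub-Bergman projection $\widetilde{\mathbf{B}^p}$ is the orthogonal projection of $L^2(\Omega)$ onto $G^{2,p}(\Omega)$. *)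

theory Defs
  imports "HOL-Analysis.Analysis"
begin

text \<open>Holomorphy in several variables on an open set: Frechet differentiability with a
  complex-linear derivative (the real-linearity is part of \<open>has_derivative\<close>).\<close>

definition holomorphic_Cn :: "(complex ^ 'n \<Rightarrow> complex) \<Rightarrow> (complex ^ 'n) set \<Rightarrow> bool" where
  "holomorphic_Cn f \<Omega> \<longleftrightarrow>
     (\<forall>z\<in>\<Omega>. \<exists>D. (f has_derivative D) (at z) \<and> (\<forall>c v. D (c *s v) = c * D v))"

text \<open>Elements of \<open>L\<^sup>p\<close> are given by representatives; only their values on \<open>\<Omega>\<close> matter.\<close>

definition Lp_space :: "real \<Rightarrow> (complex ^ 'n) set \<Rightarrow> (complex ^ 'n \<Rightarrow> complex) set" where
  "Lp_space p \<Omega> = {f. f \<in> borel_measurable (lebesgue_on \<Omega>) \<and>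
                      integrable (lebesgue_on \<Omega>) (\<lambda>z. norm (f z) powr p)}"

definition Lp_norm :: "real \<Rightarrow> (complex ^ 'n) set \<Rightarrow> (complex ^ 'n \<Rightarrow> complex) \<Rightarrow> real" where
  "Lp_norm p \<Omega> f = (LINT z|lebesgue_on \<Omega>. norm (f z) powr p) powr (1 / p)"

definition L2_inner ::
  "(complex ^ 'n) set \<Rightarrow> (complex ^ 'n \<Rightarrow> complex) \<Rightarrow> (complex ^ 'n \<Rightarrow> complex) \<Rightarrow> complex" where
  "L2_inner \<Omega> f g = (LINT z|lebesgue_on \<Omega>. f z * cnj (g z))"

text \<open>A function on \<open>\<Omega>\<close> is encoded by its extension by zero to the whole space, so that
  equality of elements of the Bergman space is equality of the functions on \<open>\<Omega>\<close>.\<close>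

definition bergman_space :: "real \<Rightarrow> (complex ^ 'n) set \<Rightarrow> (complex ^ 'n \<Rightarrow> complex) set" where
  "bergman_space p \<Omega> = {f. holomorphic_Cn f \<Omega> \<and> f \<in> Lp_space p \<Omega> \<and> (\<forall>z. z \<notin> \<Omega> \<longrightarrow> f z = 0)}"

text \<open>The closure of \<open>A\<^sup>p(\<Omega>)\<close> in \<open>A\<^sup>2(\<Omega>)\<close>. It is meant for bounded \<open>\<Omega>\<close> and \<open>p \<ge> 2\<close>,
  in which case \<open>A\<^sup>p(\<Omega>) \<subseteq> A\<^sup>2(\<Omega>)\<close>.\<close>

definition G2_space :: "real \<Rightarrow> (complex ^ 'n) set \<Rightarrow> (complex ^ 'n \<Rightarrow> complex) set" where
  "G2_space p \<Omega> = {f \<in> bergman_space 2 \<Omega>.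
      \<forall>\<epsilon>>0. \<exists>h\<in>bergman_space p \<Omega>. Lp_norm 2 \<Omega> (\<lambda>z. f z - h z) < \<epsilon>}"

definition L2_orthogonal_projection ::
  "(complex ^ 'n) set \<Rightarrow> (complex ^ 'n \<Rightarrow> complex) set \<Rightarrow>
     (complex ^ 'n \<Rightarrow> complex) \<Rightarrow> (complex ^ 'n \<Rightarrow> complex)" where
  "L2_orthogonal_projection \<Omega> V g =
     (THE f. f \<in> V \<and> (\<forall>k\<in>V. L2_inner \<Omega> (\<lambda>z. g z - f z) k = 0))"

definition sub_bergman_projection ::
  "real \<Rightarrow> (complex ^ 'n) set \<Rightarrow> (complex ^ 'n \<Rightarrow> complex) \<Rightarrow> (complex ^ 'n \<Rightarrow> complex)" where
  "sub_bergman_projection p \<Omega> = L2_orthogonal_projection \<Omega> (G2_space p \<Omega>)"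

definition hartogs_triangle :: "real \<Rightarrow> (complex ^ 2) set" where
  "hartogs_triangle \<gamma> = {z. norm (z $ 1) powr \<gamma> < norm (z $ 2) \<and> norm (z $ 2) < 1}"

end

theory Submission
  imports Defs "HOL-Complex_Analysis.Cauchy_Integral_Formula"
begin

text \<open>On \<open>G\<^bsup>2,p\<^esup>\<close> the statement is Pythagoras' theorem, because \<open>A\<^sup>p \<subseteq> G\<^bsup>2,p\<^esup>\<close> when \<open>\<Omega>\<close> is
  bounded and \<open>p \<ge> 2\<close>. The substance is that the projection exists, that is, that \<open>A\<^sup>2\<close> is complete.
  Averaging the one-variable mean value inequality for \<open>\<bar>f\<bar>\<^sup>2\<close> over all complex lines through
  a point bounds \<open>f\<close> at that point by its \<open>L\<^sup>2\<close> norm. Hence an \<open>L\<^sup>2\<close>-Cauchy sequence in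
  \<open>A\<^sup>2\<close> converges locally uniformly to a holomorphic function, which is also its \<open>L\<^sup>2\<close> limit
  by Fatou's lemma. The same bound shows that an element of \<open>A\<^sup>2\<close> with zero norm vanishes
  identically, which makes the projection unique as a function.\<close>

subsection \<open>Rotation invariance of Lebesgue measure\<close>

lemma nn_integral_lborel_translate:
  fixes c :: "'a::euclidean_space"
  assumes "f \<in> borel_measurable borel"
  shows "(\<integral>\<^sup>+x. f (c + x) \<partial>lborel) = (\<integral>\<^sup>+x. f x \<partial>lborel)"
proof -
  have "(\<integral>\<^sup>+x. f x \<partial>lborel) = (\<integral>\<^sup>+x. f x \<partial>distr lborel borel ((+) c))"
    by (simp add: lborel_distr_plus)
  also have "\<dots> = (\<integral>\<^sup>+x. f (c + x) \<partial>lborel)"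
    using assms by (subst nn_integral_distr) auto
  finally show ?thesis by simp
qed

text \<open>Uniqueness of Haar measure in concrete form: the push-forward under \<open>T\<close> is
  translation invariant because \<open>T\<close> is surjective. Take \<open>A\<close> to be the unit
  ball, which \<open>T\<close> preserves. Tonelli for
  \<open>indicator A x * indicator B (T y + x)\<close> then yields \<open>emeasure lborel A\<close>
  times the push-forward measure of \<open>B\<close> in one order, and
  \<open>emeasure lborel A\<close> times its Lebesgue measure in the other. The common factor is
  positive and finite, so it cancels.\<close>

lemma lborel_distr_linear_isometry:
  fixes T :: "'a::euclidean_space \<Rightarrow> 'a"
  assumes lin: "linear T" and iso: "\<And>x. norm (T x) = norm x"
  shows "distr lborel borel T = lborel"
proof (rule measure_eqI)
  show "sets (distr lborel borel T) = sets lborel" by simp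
  fix B assume "B \<in> sets (distr lborel borel T)"
  then have B[measurable]: "B \<in> sets borel" by simp
  have T[measurable]: "T \<in> borel_measurable borel"
    using lin by (simp add: borel_measurable_continuous_onI linear_continuous_on linear_conv_bounded_linear)
  have "inj T"
    using lin iso by (metis linear_injective_0 norm_eq_zero)
  then have surj: "surj T"
    using lin linear_injective_imp_surjective by blast
  define A where "A = ball (0::'a) 1"
  have [measurable]: "A \<in> sets borel" by (simp add: A_def)
  have "emeasure lborel A * emeasure (distr lborel borel T) B
      = (\<integral>\<^sup>+x. indicator A x * (\<integral>\<^sup>+y. indicator B (T y + x) \<partial>lborel) \<partial>lborel)"
  proof -
    have "(\<integral>\<^sup>+y. indicator B (T y + x) \<partial>lborel) = emeasure (distr lborel borel T) B" for x
    proof -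
      obtain b where b: "T b = x" using surj by (metis surjD)
      have "(\<integral>\<^sup>+y. indicator B (T y + x) \<partial>lborel) = (\<integral>\<^sup>+y. indicator B (T (b + y)) \<partial>lborel)"
        using lin by (simp add: linear_add b add.commute)
      also have "\<dots> = (\<integral>\<^sup>+y. indicator B (T y) \<partial>lborel)"
        by (rule nn_integral_lborel_translate) measurable
      also have "\<dots> = (\<integral>\<^sup>+y. indicator B y \<partial>distr lborel borel T)"
        by (subst nn_integral_distr) auto
      finally show ?thesis by simp
    qed
    then show ?thesis
      by (simp add: nn_integral_multc)
  qed
  also have "\<dots> = (\<integral>\<^sup>+x. (\<integral>\<^sup>+y. indicator A x * indicator B (T y + x) \<partial>lborel) \<partial>lborel)"
    by (intro nn_integral_cong nn_integral_cmult[symmetric]) measurable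
  also have "\<dots> = (\<integral>\<^sup>+y. (\<integral>\<^sup>+x. indicator A x * indicator B (T y + x) \<partial>lborel) \<partial>lborel)"
    by (rule lborel_pair.Fubini'[symmetric]) measurable
  also have "\<dots> = (\<integral>\<^sup>+y. (\<integral>\<^sup>+u. indicator A (u - T y) * indicator B u \<partial>lborel) \<partial>lborel)"
  proof (rule nn_integral_cong)
    fix y
    have "(\<lambda>u. indicator A (u - T y) * indicator B u :: ennreal) \<in> borel_measurable borel"
      by measurable
    from nn_integral_lborel_translate[OF this, of "T y"]
    show "(\<integral>\<^sup>+x. indicator A x * indicator B (T y + x) \<partial>lborel)
        = (\<integral>\<^sup>+u. indicator A (u - T y) * indicator B u \<partial>lborel)" by simp
  qed
  also have "\<dots> = (\<integral>\<^sup>+u. (\<integral>\<^sup>+y. indicator A (u - T y) * indicator B u \<partial>lborel) \<partial>lborel)"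
    by (rule lborel_pair.Fubini') measurable
  also have "\<dots> = (\<integral>\<^sup>+u. emeasure lborel A * indicator B u \<partial>lborel)"
  proof (rule nn_integral_cong)
    fix u
    obtain c where c: "T c = u" using surj by (metis surjD)
    \<comment> \<open>Since \<open>u - T y = T (c - y)\<close>, the admissible \<open>y\<close> for
      a fixed \<open>u\<close> form the unit ball about \<open>c\<close>.\<close>
    have "norm (u - T y) = norm (- c + y)" for y
      using iso[of "c - y"] lin by (simp add: linear_diff c norm_minus_commute)
    then have "(\<integral>\<^sup>+y. indicator A (u - T y) \<partial>lborel) = (\<integral>\<^sup>+y. indicator A (- c + y) \<partial>lborel)"
      by (intro nn_integral_cong) (simp add: A_def indicator_def)
    also have "\<dots> = emeasure lborel A"
      by (subst nn_integral_lborel_translate) auto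
    finally show "(\<integral>\<^sup>+y. indicator A (u - T y) * indicator B u \<partial>lborel)
        = emeasure lborel A * indicator B u"
      by (simp add: nn_integral_multc)
  qed
  also have "\<dots> = emeasure lborel A * emeasure lborel B"
    by (simp add: nn_integral_cmult)
  finally have *: "emeasure lborel A * emeasure (distr lborel borel T) B
      = emeasure lborel A * emeasure lborel B" .
  have "emeasure lborel A \<noteq> 0"
    using content_ball_pos[of 1 "0::'a"] by (auto simp: A_def measure_def)
  moreover have "emeasure lborel A \<noteq> \<infinity>"
    unfolding A_def using emeasure_lborel_ball_finite[of 0 1] by (metis infinity_ennreal_def less_irrefl)
  ultimately show "emeasure (distr lborel borel T) B = emeasure lborel B"
    using * by (simp add: ennreal_mult_cancel_left)
qed

subsection \<open>Holomorphic functions of several variables\<close>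

lemma norm_vector_smult: "norm (c *s (v :: complex ^ 'n)) = norm c * norm v"
proof -
  have "(\<lambda>i. norm (c * v $ i)) = (\<lambda>i. norm c * norm (v $ i))" by (simp add: norm_mult)
  then show ?thesis by (simp add: norm_vec_def L2_set_right_distrib)
qed

lemma holomorphic_Cn_subset: "holomorphic_Cn f T \<Longrightarrow> S \<subseteq> T \<Longrightarrow> holomorphic_Cn f S"
  by (auto simp: holomorphic_Cn_def)

lemma holomorphic_Cn_imp_continuous_on: "holomorphic_Cn f S \<Longrightarrow> continuous_on S f"
  by (meson continuous_at_imp_continuous_on has_derivative_continuous holomorphic_Cn_def)

lemma bounded_linear_smult_vec: "bounded_linear (\<lambda>\<zeta>. \<zeta> *s (w :: complex ^ 'n))"
  by (rule bounded_linear_intro[where K = "norm w"])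
     (auto simp: vec_eq_iff algebra_simps norm_vector_smult)

text \<open>Restriction to a complex line. The chain rule gives only the real-linear derivative
  \<open>\<lambda>c. D (c *s w)\<close>; complex linearity of \<open>D\<close> turns it into
  multiplication by \<open>D w\<close>.\<close>

lemma slice_has_field_derivative:
  fixes a w :: "complex ^ 'n"
  assumes D: "(f has_derivative D) (at (a + \<zeta> *s w))" and lin: "\<And>c v. D (c *s v) = c * D v"
  shows "((\<lambda>\<zeta>. f (a + \<zeta> *s w)) has_field_derivative D w) (at \<zeta>)"
proof -
  have "((\<lambda>\<zeta>. a + \<zeta> *s w) has_derivative (\<lambda>\<zeta>. \<zeta> *s w)) (at \<zeta>)"
    by (rule has_derivative_eq_rhs[OF has_derivative_add[OF has_derivative_const
          bounded_linear_imp_has_derivative[OF bounded_linear_smult_vec]]]) simp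
  from has_derivative_compose[OF this D]
  have "((\<lambda>\<zeta>. f (a + \<zeta> *s w)) has_derivative (\<lambda>c. D (c *s w))) (at \<zeta>)" by simp
  then show ?thesis
    by (simp add: has_field_derivative_def lin mult.commute[of _ "D w"])
qed

lemma slice_holomorphic:
  fixes a w :: "complex ^ 'n"
  assumes f: "holomorphic_Cn f (ball a r)" and w: "R * norm w \<le> r" "w \<noteq> 0"
  shows "(\<lambda>\<zeta>. f (a + \<zeta> *s w)) holomorphic_on ball 0 R"
proof -
  have "\<exists>d. ((\<lambda>\<zeta>. f (a + \<zeta> *s w)) has_field_derivative d) (at \<zeta>)" if "\<zeta> \<in> ball 0 R" for \<zeta>
  proof -
    have "norm \<zeta> * norm w < R * norm w" using that w by simp
    then have "a + \<zeta> *s w \<in> ball a r"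
      using w(1) by (simp add: dist_norm norm_vector_smult)
    then show ?thesis
      using f slice_has_field_derivative unfolding holomorphic_Cn_def by blast
  qed
  then show ?thesis by (simp add: holomorphic_on_open)
qed

section \<open>Sub-mean value inequality on circles and on balls\<close>

lemma circle_mean_value:
  assumes "\<phi> holomorphic_on cball 0 1"
  shows "((\<lambda>t. \<phi> (cis (2 * pi * t))) has_integral \<phi> 0) {0..1}"
proof -
  have "((\<lambda>u. \<phi> u / u) has_contour_integral (2 * of_real pi * \<i> * \<phi> 0)) (circlepath 0 1)"
    using Cauchy_integral_circlepath_simple[OF assms, of 0] by simp
  \<comment> \<open>On the unit circle the path has derivative
    \<open>2 * of_real pi * \<i> * u\<close>, which cancels the denominator
    \<open>u\<close>.\<close>
  then have "((\<lambda>t. 2 * of_real pi * \<i> * \<phi> (cis (2 * pi * t))) has_integral (2 * of_real pi * \<i> * \<phi> 0)) {0..1}"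
    unfolding has_contour_integral
    by (rule has_integral_eq[rotated])
       (simp add: vector_derivative_circlepath, simp add: circlepath cis_conv_exp mult_ac)
  from has_integral_mult_right[OF this, of "1 / (2 * of_real pi * \<i>)"]
  show ?thesis by simp
qed

text \<open>The square of \<open>\<phi>\<close> is again holomorphic, so the mean value property
  applies to it, and absolute values are then taken under the integral. The result is stated with a
  nonnegative integral so that Tonelli can be used in the averaging below.\<close>

lemma circle_sub_mean_value:
  assumes \<phi>: "\<phi> holomorphic_on cball 0 1"
  shows "ennreal ((norm (\<phi> 0))\<^sup>2)
     \<le> (\<integral>\<^sup>+t. indicator {0..1} t * ennreal ((norm (\<phi> (cis (2 * pi * t))))\<^sup>2) \<partial>lborel)"
proof -
  define \<psi> where "\<psi> t = (\<phi> (cis (2 * pi * t)))\<^sup>2" for t :: real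
  have int: "(\<psi> has_integral (\<phi> 0)\<^sup>2) {0..1}"
    unfolding \<psi>_def by (rule circle_mean_value) (intro holomorphic_intros \<phi>)
  have "continuous_on {0..1} \<psi>"
    unfolding \<psi>_def
    by (intro continuous_intros continuous_on_compose2[OF holomorphic_on_imp_continuous_on[OF \<phi>]]) auto
  then have si: "set_integrable lborel {0..1} \<psi>"
    by (rule borel_integrable_atLeastAtMost')
  have "(\<phi> 0)\<^sup>2 = (LINT t:{0..1}|lborel. \<psi> t)"
    using set_borel_integral_eq_integral(2)[OF si] int by (simp add: integral_unique)
  then have "ennreal ((norm (\<phi> 0))\<^sup>2) = ennreal (norm (LINT t|lborel. indicator {0..1} t *\<^sub>R \<psi> t))"
    by (simp add: set_lebesgue_integral_def flip: norm_power)
  also have "\<dots> \<le> (\<integral>\<^sup>+t. ennreal (norm (indicator {0..1} t *\<^sub>R \<psi> t)) \<partial>lborel)"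
    using si unfolding set_integrable_def by (rule integral_norm_bound_ennreal)
  also have "\<dots> = (\<integral>\<^sup>+t. indicator {0..1} t * ennreal ((norm (\<phi> (cis (2 * pi * t))))\<^sup>2) \<partial>lborel)"
    by (intro nn_integral_cong) (simp add: \<psi>_def norm_power indicator_def)
  finally show ?thesis .
qed

text \<open>The mean value inequality on every complex line through \<open>a\<close> is averaged over the ball;
  the rotations of these lines preserve Lebesgue measure.\<close>

lemma ball_sub_mean_value:
  fixes a :: "complex ^ 'n"
  assumes f: "holomorphic_Cn f (ball a r)"
  shows "ennreal ((norm (f a))\<^sup>2) * emeasure lborel (ball a r)
     \<le> (\<integral>\<^sup>+z. indicator (ball a r) z * ennreal ((norm (f z))\<^sup>2) \<partial>lborel)"
proof -
  define F :: "complex ^ 'n \<Rightarrow> ennreal"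
    where "F w = indicator (ball 0 r) w * ennreal ((norm (f (a + w)))\<^sup>2)" for w
  define G :: "complex ^ 'n \<Rightarrow> ennreal"
    where "G z = indicator (ball a r) z * ennreal ((norm (f z))\<^sup>2)" for z
  \<comment> \<open>Continuity of \<open>f\<close> is known only on the open ball; cutting off by
    its indicator makes the product Borel on the whole space.\<close>
  have "continuous_on (ball a r) (\<lambda>z. (norm (f z))\<^sup>2)"
    by (intro continuous_intros holomorphic_Cn_imp_continuous_on f)
  then have "(\<lambda>z. indicator (ball a r) z *\<^sub>R (norm (f z))\<^sup>2) \<in> borel_measurable borel"
    by (intro borel_measurable_continuous_on_indicator) auto
  then have "(\<lambda>z. ennreal (indicator (ball a r) z *\<^sub>R (norm (f z))\<^sup>2)) \<in> borel_measurable borel"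
    by measurable
  also have "(\<lambda>z. ennreal (indicator (ball a r) z *\<^sub>R (norm (f z))\<^sup>2)) = G"
    by (auto simp: G_def indicator_def)
  finally have G[measurable]: "G \<in> borel_measurable borel" .
  have F_eq: "F w = G (a + w)" for w
    by (simp add: F_def G_def indicator_def dist_norm)
  have F[measurable]: "F \<in> borel_measurable borel"
    unfolding F_eq by measurable
  have "emeasure lborel (ball a r) = (\<integral>\<^sup>+w. indicator (ball a r) (a + w) \<partial>lborel)"
    by (subst nn_integral_lborel_translate) (auto intro!: borel_measurable_indicator)
  also have "\<dots> = (\<integral>\<^sup>+w. indicator (ball (0 :: complex ^ 'n) r) w \<partial>lborel)"
    by (simp add: indicator_def dist_norm)
  also have "\<dots> = emeasure lborel (ball (0 :: complex ^ 'n) r)"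
    by simp
  finally have "ennreal ((norm (f a))\<^sup>2) * emeasure lborel (ball a r)
      = (\<integral>\<^sup>+w. indicator (ball (0 :: complex ^ 'n) r) w * ennreal ((norm (f a))\<^sup>2) \<partial>lborel)"
    by (subst nn_integral_multc) (simp_all add: mult.commute borel_measurable_indicator)
  \<comment> \<open>For \<open>w\<close> in the ball, the closed disc of all
    \<open>\<zeta> *s w\<close> with \<open>norm \<zeta> \<le> 1\<close> stays in it, so the circle
    inequality applies to that slice; for \<open>w = 0\<close> the slice is constant.\<close>
  also have "\<dots> \<le> (\<integral>\<^sup>+w. (\<integral>\<^sup>+t. indicator {0..1} t * F (cis (2 * pi * t) *s w) \<partial>lborel) \<partial>lborel)"
  proof (rule nn_integral_mono)
    fix w :: "complex ^ 'n"
    show "indicator (ball 0 r) w * ennreal ((norm (f a))\<^sup>2)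
        \<le> (\<integral>\<^sup>+t. indicator {0..1} t * F (cis (2 * pi * t) *s w) \<partial>lborel)"
    proof (cases "w \<in> ball 0 r")
      case True
      have "(\<lambda>\<zeta>. f (a + \<zeta> *s w)) holomorphic_on cball 0 1"
      proof (cases "w = 0")
        case False
        have "(\<lambda>\<zeta>. f (a + \<zeta> *s w)) holomorphic_on ball 0 (r / norm w)"
          using False by (intro slice_holomorphic[OF f]) auto
        then show ?thesis
          by (rule holomorphic_on_subset) (use False True in \<open>auto simp: field_simps\<close>,
              metis (no_types) mult.commute mult_left_le_one_le norm_ge_zero order.strict_trans1 zero_less_norm_iff mult_left_le)
      qed auto
      from circle_sub_mean_value[OF this] show ?thesis
        using True by (simp add: F_def norm_vector_smult indicator_def)
    qed auto
  qed
  also have "\<dots> = (\<integral>\<^sup>+t. (\<integral>\<^sup>+w. indicator {0..1} t * F (cis (2 * pi * t) *s w) \<partial>lborel) \<partial>lborel)"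
  proof (rule lborel_pair.Fubini')
    have "continuous_on UNIV (\<lambda>x :: real \<times> (complex ^ 'n). cis (2 * pi * fst x) *s snd x)"
      unfolding vector_scalar_mult_def
      by (intro continuous_intros continuous_on_vec_lambda)
    then have [measurable]: "(\<lambda>x :: real \<times> (complex ^ 'n). cis (2 * pi * fst x) *s snd x) \<in> borel \<Otimes>\<^sub>M borel \<rightarrow>\<^sub>M borel"
      unfolding borel_prod by (rule borel_measurable_continuous_onI)
    show "(\<lambda>(t, w). indicator {0..1} t * F (cis (2 * pi * t) *s w))
        \<in> borel_measurable (lborel \<Otimes>\<^sub>M lborel)"
      unfolding case_prod_beta by measurable
  qed
  \<comment> \<open>For a fixed angle, multiplication by \<open>cis (2 * pi * t)\<close> is a linear
    isometry, so the inner integral does not depend on \<open>t\<close>.\<close>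
  also have "\<dots> = (\<integral>\<^sup>+t. indicator {0..1} (t::real) * (\<integral>\<^sup>+w. F w \<partial>lborel) \<partial>lborel)"
  proof (rule nn_integral_cong)
    fix t :: real
    define T where "T w = cis (2 * pi * t) *s (w :: complex ^ 'n)" for w
    have "linear T"
      by (rule linearI) (simp_all add: T_def vec_eq_iff algebra_simps)
    have iso: "norm (T x) = norm x" for x by (simp add: T_def norm_vector_smult)
    have [measurable]: "T \<in> borel_measurable borel"
      using \<open>linear T\<close> by (simp add: borel_measurable_continuous_onI linear_continuous_on linear_conv_bounded_linear)
    have "(\<integral>\<^sup>+w. F (T w) \<partial>lborel) = (\<integral>\<^sup>+w. F w \<partial>distr lborel borel T)"
      by (subst nn_integral_distr) auto
    then have "(\<integral>\<^sup>+w. F (T w) \<partial>lborel) = (\<integral>\<^sup>+w. F w \<partial>lborel)"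
      by (simp add: lborel_distr_linear_isometry[OF \<open>linear T\<close> iso])
    then show "(\<integral>\<^sup>+w. indicator {0..1} t * F (cis (2 * pi * t) *s w) \<partial>lborel)
        = indicator {0..1} t * (\<integral>\<^sup>+w. F w \<partial>lborel)"
      by (subst nn_integral_cmult) (auto simp: T_def[symmetric])
  qed
  also have "\<dots> = (\<integral>\<^sup>+w. F w \<partial>lborel)"
    by (simp add: nn_integral_multc)
  also have "\<dots> = (\<integral>\<^sup>+z. G z \<partial>lborel)"
    unfolding F_eq by (rule nn_integral_lborel_translate) measurable
  finally show ?thesis by (simp add: G_def)
qed

section \<open>Algebra of holomorphic functions, Cauchy estimate and locally uniform limits\<close>

lemma holomorphic_Cn_diff:
  assumes "holomorphic_Cn f S" "holomorphic_Cn g S"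
  shows "holomorphic_Cn (\<lambda>z. f z - g z) S"
  unfolding holomorphic_Cn_def
proof
  fix z assume "z \<in> S"
  with assms obtain D E where
    "(f has_derivative D) (at z)" "\<forall>c v. D (c *s v) = c * D v"
    "(g has_derivative E) (at z)" "\<forall>c v. E (c *s v) = c * E v"
    unfolding holomorphic_Cn_def by meson
  then show "\<exists>D. ((\<lambda>z. f z - g z) has_derivative D) (at z) \<and> (\<forall>c v. D (c *s v) = c * D v)"
    by (intro exI[of _ "\<lambda>v. D v - E v"]) (auto simp: algebra_simps intro!: derivative_intros)
qed

lemma holomorphic_Cn_cmult:
  assumes "holomorphic_Cn f S"
  shows "holomorphic_Cn (\<lambda>z. b * f z) S"
  unfolding holomorphic_Cn_def
proof
  fix z assume "z \<in> S"
  with assms obtain D where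
    "(f has_derivative D) (at z)" "\<forall>c v. D (c *s v) = c * D v"
    unfolding holomorphic_Cn_def by meson
  then show "\<exists>D. ((\<lambda>z. b * f z) has_derivative D) (at z) \<and> (\<forall>c v. D (c *s v) = c * D v)"
    by (intro exI[of _ "\<lambda>v. b * D v"]) (auto simp: algebra_simps intro!: derivative_intros)
qed

lemma holomorphic_Cn_add:
  assumes "holomorphic_Cn f S" "holomorphic_Cn g S"
  shows "holomorphic_Cn (\<lambda>z. f z + g z) S"
  using holomorphic_Cn_diff[OF assms(1) holomorphic_Cn_cmult[OF assms(2), of "-1"]] by simp

lemma holomorphic_Cn_0: "holomorphic_Cn (\<lambda>z. 0) S"
  unfolding holomorphic_Cn_def by (intro ballI exI[of _ "\<lambda>v. 0"]) auto

text \<open>Cauchy's inequality for the slice through \<open>a\<close> in direction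
  \<open>v\<close>. The slice is controlled only on the open disc of radius
  \<open>r / norm v\<close>, so the circle of half that radius is used; this is the source of the
  factor 2.\<close>

lemma holomorphic_Cn_derivative_bound:
  fixes a v :: "complex ^ 'n"
  assumes f: "holomorphic_Cn f (ball a r)" and "0 < r"
    and B: "\<And>z. z \<in> ball a r \<Longrightarrow> norm (f z) \<le> B"
    and D: "(f has_derivative D) (at a)" "\<And>c v. D (c *s v) = c * D v"
  shows "norm (D v) \<le> 2 * B / r * norm v"
proof (cases "v = 0")
  case True
  then show ?thesis using D(2)[of 0 0] by simp
next
  case False
  define R where "R = r / norm v"
  have "R > 0" using False \<open>r > 0\<close> by (simp add: R_def)
  have hol: "(\<lambda>\<zeta>. f (a + \<zeta> *s v)) holomorphic_on ball 0 R"
    using False by (intro slice_holomorphic[OF f]) (auto simp: R_def)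
  have "norm ((deriv ^^ 1) (\<lambda>\<zeta>. f (a + \<zeta> *s v)) 0) \<le> fact 1 * B / (R / 2) ^ 1"
  proof (rule Cauchy_inequality)
    have "cball 0 (R / 2) \<subseteq> ball (0::complex) R" using \<open>R > 0\<close> by auto
    then show "continuous_on (cball 0 (R / 2)) (\<lambda>\<zeta>. f (a + \<zeta> *s v))"
      using hol holomorphic_on_imp_continuous_on holomorphic_on_subset by blast
    show "(\<lambda>\<zeta>. f (a + \<zeta> *s v)) holomorphic_on ball 0 (R / 2)"
      using hol by (rule holomorphic_on_subset) (use \<open>R > 0\<close> in auto)
    show "norm (f (a + x *s v)) \<le> B" if "norm (0 - x) = R / 2" for x
      using that False \<open>r > 0\<close> by (intro B) (simp add: dist_norm norm_vector_smult R_def)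
  qed (use \<open>R > 0\<close> in simp)
  moreover have "deriv (\<lambda>\<zeta>. f (a + \<zeta> *s v)) 0 = D v"
    using D by (intro DERIV_imp_deriv slice_has_field_derivative) auto
  ultimately show ?thesis by (simp add: R_def field_simps)
qed

text \<open>Around each point of \<open>ball a r\<close> there is a ball of radius \<open>r\<close>
  inside \<open>ball a (2 * r)\<close>. The Cauchy estimate there makes the derivatives uniformly
  Cauchy in operator norm, so the sequence may be differentiated term by term, and complex linearity
  passes to the limit.\<close>

lemma holomorphic_Cn_uniform_limit:
  fixes a :: "complex ^ 'n"
  assumes hol: "\<And>n. holomorphic_Cn (f n) (ball a (2 * r))" and "0 < r"
    and Cauchy: "\<And>e. 0 < e \<Longrightarrow> \<exists>N. \<forall>m\<ge>N. \<forall>n\<ge>N. \<forall>x\<in>ball a (2 * r). norm (f m x - f n x) \<le> e"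
    and lim: "\<And>x. x \<in> ball a (2 * r) \<Longrightarrow> (\<lambda>n. f n x) \<longlonglongrightarrow> g x"
  shows "holomorphic_Cn g (ball a r)"
proof -
  have sub: "ball x r \<subseteq> ball a (2 * r)" if "x \<in> ball a r" for x
    using that by (intro subsetI) (auto, smt (verit) dist_triangle)
  have "\<exists>D. \<forall>n x. x \<in> ball a (2 * r) \<longrightarrow>
      (f n has_derivative D n x) (at x) \<and> (\<forall>c v. D n x (c *s v) = c * D n x v)"
    using hol unfolding holomorphic_Cn_def by metis
  then obtain D where
    D: "\<And>n x. x \<in> ball a (2 * r) \<Longrightarrow> (f n has_derivative D n x) (at x)" and
    D_lin: "\<And>n x c v. x \<in> ball a (2 * r) \<Longrightarrow> D n x (c *s v) = c * D n x v"
    by blast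
  have D_Cauchy: "\<exists>N. \<forall>m\<ge>N. \<forall>n\<ge>N. \<forall>x\<in>ball a r. \<forall>v. norm (D m x v - D n x v) \<le> e * norm v"
    if "0 < e" for e
  proof -
    \<comment> \<open>This tolerance cancels the factor \<open>2 / r\<close> of the derivative
      bound.\<close>
    have "0 < e * r / 2" using that \<open>0 < r\<close> by simp
    from Cauchy[OF this] obtain N where
      N: "\<And>m n x. N \<le> m \<Longrightarrow> N \<le> n \<Longrightarrow> x \<in> ball a (2 * r) \<Longrightarrow> norm (f m x - f n x) \<le> e * r / 2"
      by blast
    have "norm (D m x v - D n x v) \<le> e * norm v" if "N \<le> m" "N \<le> n" "x \<in> ball a r" for m n x v
    proof -
      have x: "x \<in> ball a (2 * r)" using sub[OF that(3)] \<open>0 < r\<close> by (meson centre_in_ball subsetD)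
      have "norm (D m x v - D n x v) \<le> 2 * (e * r / 2) / r * norm v"
      proof (rule holomorphic_Cn_derivative_bound)
        show "holomorphic_Cn (\<lambda>z. f m z - f n z) (ball x r)"
          using hol sub[OF that(3)] by (blast intro: holomorphic_Cn_diff holomorphic_Cn_subset)
        show "((\<lambda>z. f m z - f n z) has_derivative (\<lambda>v. D m x v - D n x v)) (at x)"
          by (intro has_derivative_diff D x)
      qed (use \<open>0 < r\<close> N that sub[OF that(3)] D_lin[OF x] in \<open>auto simp: algebra_simps\<close>)
      then show ?thesis using \<open>0 < r\<close> by simp
    qed
    then show ?thesis by blast
  qed
  have "\<exists>l. (\<lambda>n. D n x v) \<longlonglongrightarrow> l" if "x \<in> ball a r" for x v
  proof -
    have "\<exists>N. \<forall>m\<ge>N. \<forall>n\<ge>N. norm (D m x v - D n x v) < e" if "0 < e" for e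
    proof -
      \<comment> \<open>The summand 1 covers \<open>v = 0\<close> and makes the final inequality
        strict.\<close>
      have "0 < e / (norm v + 1)" using that by (simp add: add_nonneg_pos)
      then obtain N where
        N: "\<And>m n. N \<le> m \<Longrightarrow> N \<le> n \<Longrightarrow> norm (D m x v - D n x v) \<le> e / (norm v + 1) * norm v"
        using D_Cauchy \<open>x \<in> ball a r\<close> by meson
      have "e / (norm v + 1) * norm v < e"
        using that by (simp add: add_nonneg_pos divide_simps mult_less_cancel_left)
      then show ?thesis using N by (meson le_less_trans)
    qed
    then show ?thesis by (metis CauchyI Cauchy_convergent_iff convergent_def)
  qed
  then obtain D' where D': "\<And>x v. x \<in> ball a r \<Longrightarrow> (\<lambda>n. D n x v) \<longlonglongrightarrow> D' x v"
    by metis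
  have "\<exists>h. \<forall>x\<in>ball a r. (\<lambda>n. f n x) \<longlonglongrightarrow> h x \<and> (h has_derivative D' x) (at x within ball a r)"
  proof (rule has_derivative_sequence)
    show "(f n has_derivative D n x) (at x within ball a r)" if "x \<in> ball a r" for n x
      using D sub[OF that] \<open>0 < r\<close> by (metis has_derivative_at_withinI centre_in_ball subsetD)
    show "\<forall>\<^sub>F n in sequentially. \<forall>x\<in>ball a r. \<forall>v. norm (D n x v - D' x v) \<le> e * norm v"
      if "0 < e" for e
    proof -
      obtain N where
        N: "\<And>m n x v. N \<le> m \<Longrightarrow> N \<le> n \<Longrightarrow> x \<in> ball a r \<Longrightarrow> norm (D m x v - D n x v) \<le> e * norm v"
        using D_Cauchy[OF \<open>0 < e\<close>] by blast
      have "norm (D n x v - D' x v) \<le> e * norm v" if "N \<le> n" "x \<in> ball a r" for n x v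
      proof (rule LIMSEQ_le_const2)
        show "(\<lambda>m. norm (D n x v - D m x v)) \<longlonglongrightarrow> norm (D n x v - D' x v)"
          by (intro tendsto_intros D' that)
        show "\<exists>N. \<forall>m\<ge>N. norm (D n x v - D m x v) \<le> e * norm v"
          using N that by blast
      qed
      then show ?thesis unfolding eventually_sequentially by blast
    qed
    show "(\<lambda>n. f n a) \<longlonglongrightarrow> g a" using \<open>0 < r\<close> by (intro lim) simp
  qed (use \<open>0 < r\<close> in auto)
  then obtain h where h: "\<And>x. x \<in> ball a r \<Longrightarrow> (\<lambda>n. f n x) \<longlonglongrightarrow> h x"
    "\<And>x. x \<in> ball a r \<Longrightarrow> (h has_derivative D' x) (at x within ball a r)"
    by blast
  \<comment> \<open>Term-by-term differentiation only supplies some limit function \<open>h\<close>;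
    uniqueness of pointwise limits identifies it with \<open>g\<close>.\<close>
  have "g x = h x" if "x \<in> ball a r" for x
    using LIMSEQ_unique[OF lim h(1)[OF that]] sub[OF that] \<open>0 < r\<close>
    by (meson centre_in_ball subsetD)
  then have "(g has_derivative D' x) (at x)" if "x \<in> ball a r" for x
    using h(2)[OF that] that by (metis at_within_open has_derivative_transform open_ball)
  moreover have "D' x (c *s v) = c * D' x v" if "x \<in> ball a r" for x c v
  proof (rule LIMSEQ_unique[OF D'[OF that]])
    have "x \<in> ball a (2 * r)" using sub[OF that] \<open>0 < r\<close> by (meson centre_in_ball subsetD)
    moreover have "(\<lambda>n. c * D n x v) \<longlonglongrightarrow> c * D' x v" by (intro tendsto_intros D' that)
    ultimately show "(\<lambda>n. D n x (c *s v)) \<longlonglongrightarrow> c * D' x v" by (simp add: D_lin)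
  qed
  ultimately show ?thesis unfolding holomorphic_Cn_def by blast
qed

subsection \<open>Orthogonal projection in \<open>L\<^sup>2\<close>\<close>

definition sq_integrable :: "'a measure \<Rightarrow> ('a \<Rightarrow> complex) \<Rightarrow> bool" where
  "sq_integrable M f \<longleftrightarrow> f \<in> borel_measurable M \<and> integrable M (\<lambda>x. (norm (f x))\<^sup>2)"

text \<open>The norm is kept squared so that the parallelogram law and Pythagoras involve no roots.
  The integral of a non-integrable function is 0 by default, so finiteness is carried separately by
  \<open>sq_integrable\<close>.\<close>

definition norm_sq :: "'a measure \<Rightarrow> ('a \<Rightarrow> complex) \<Rightarrow> real" where
  "norm_sq M f = (LINT x|M. (norm (f x))\<^sup>2)"

lemma norm_sq_nonneg: "0 \<le> norm_sq M f"
  by (simp add: norm_sq_def)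

lemma norm_sq_minus_commute: "norm_sq M (\<lambda>x. f x - g x) = norm_sq M (\<lambda>x. g x - f x)"
  by (simp add: norm_sq_def norm_minus_commute)

text \<open>Young's inequality, from a square being nonnegative. It replaces the triangle inequality
  for squared norms: \<open>d = 1\<close> handles sums, and a small \<open>d\<close> keeps the
  factor on the first term close to 1 when limits are taken.\<close>

lemma norm_add_sq_le:
  fixes u v :: complex
  assumes "0 < d"
  shows "(norm (u + v))\<^sup>2 \<le> (1 + d) * (norm u)\<^sup>2 + (1 + 1 / d) * (norm v)\<^sup>2"
proof -
  have "(norm (u + v))\<^sup>2 \<le> (norm u + norm v)\<^sup>2"
    by (simp add: norm_triangle_ineq power_mono)
  also have "\<dots> = (1 + d) * (norm u)\<^sup>2 + (1 + 1 / d) * (norm v)\<^sup>2 - (d * norm u - norm v)\<^sup>2 / d"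
    using assms by (simp add: power2_eq_square field_simps)
  also have "\<dots> \<le> (1 + d) * (norm u)\<^sup>2 + (1 + 1 / d) * (norm v)\<^sup>2"
    using assms by simp
  finally show ?thesis .
qed

lemma sq_integrable_add:
  assumes f: "sq_integrable M f" and g: "sq_integrable M g"
  shows "sq_integrable M (\<lambda>x. f x + g x)"
proof -
  have [measurable]: "f \<in> borel_measurable M" "g \<in> borel_measurable M"
    using assms by (auto simp: sq_integrable_def)
  have "integrable M (\<lambda>x. (norm (f x + g x))\<^sup>2)"
  proof (rule Bochner_Integration.integrable_bound)
    show "integrable M (\<lambda>x. (1 + 1) * (norm (f x))\<^sup>2 + (1 + 1 / 1) * (norm (g x))\<^sup>2)"
      using assms by (simp add: sq_integrable_def)
    show "AE x in M. norm ((norm (f x + g x))\<^sup>2)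
        \<le> norm ((1 + 1) * (norm (f x))\<^sup>2 + (1 + 1 / 1) * (norm (g x))\<^sup>2)"
      using norm_add_sq_le[of 1] by (intro AE_I2) simp
  qed measurable
  then show ?thesis by (simp add: sq_integrable_def)
qed

lemma sq_integrable_cmult: "sq_integrable M f \<Longrightarrow> sq_integrable M (\<lambda>x. c * f x)"
  by (auto simp: sq_integrable_def norm_mult power_mult_distrib)

lemma sq_integrable_diff:
  "sq_integrable M f \<Longrightarrow> sq_integrable M g \<Longrightarrow> sq_integrable M (\<lambda>x. f x - g x)"
  using sq_integrable_add[OF _ sq_integrable_cmult[of M g "-1"]] by simp

lemma sq_integrable_inner:
  assumes f: "sq_integrable M f" and g: "sq_integrable M g"
  shows "integrable M (\<lambda>x. f x * cnj (g x))"
proof (rule Bochner_Integration.integrable_bound)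
  show "integrable M (\<lambda>x. (norm (f x))\<^sup>2 + (norm (g x))\<^sup>2)"
    using assms by (simp add: sq_integrable_def)
  have "norm (f x) * norm (g x) \<le> (norm (f x))\<^sup>2 + (norm (g x))\<^sup>2" for x
  proof -
    have "0 \<le> norm (f x) * norm (g x)" by simp
    then show ?thesis using sum_squares_bound[of "norm (f x)" "norm (g x)"] by linarith
  qed
  then show "AE x in M. norm (f x * cnj (g x)) \<le> norm ((norm (f x))\<^sup>2 + (norm (g x))\<^sup>2)"
    by (intro AE_I2) (simp add: norm_mult)
  have "(\<lambda>x. cnj (g x)) \<in> borel_measurable M"
    using g unfolding sq_integrable_def
    by (intro borel_measurable_continuous_on[where f = cnj] continuous_intros) auto
  then show "(\<lambda>x. f x * cnj (g x)) \<in> borel_measurable M"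
    using f by (intro borel_measurable_times) (simp_all add: sq_integrable_def)
qed

lemma norm_sq_cmult: "norm_sq M (\<lambda>x. c * f x) = (norm c)\<^sup>2 * norm_sq M f"
  by (simp add: norm_sq_def norm_mult power_mult_distrib)

lemma norm_sq_add_le:
  assumes f: "sq_integrable M f" and g: "sq_integrable M g" and "0 < d"
  shows "norm_sq M (\<lambda>x. f x + g x) \<le> (1 + d) * norm_sq M f + (1 + 1 / d) * norm_sq M g"
proof -
  have "norm_sq M (\<lambda>x. f x + g x) \<le> (LINT x|M. (1 + d) * (norm (f x))\<^sup>2 + (1 + 1 / d) * (norm (g x))\<^sup>2)"
    unfolding norm_sq_def
    using sq_integrable_add[OF f g] f g norm_add_sq_le[OF \<open>0 < d\<close>]
    by (intro integral_mono) (auto simp: sq_integrable_def)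
  also have "\<dots> = (1 + d) * norm_sq M f + (1 + 1 / d) * norm_sq M g"
    using f g unfolding norm_sq_def sq_integrable_def
    by (subst Bochner_Integration.integral_add) auto
  finally show ?thesis .
qed

lemma norm_sq_diff:
  assumes f: "sq_integrable M f" and g: "sq_integrable M g"
  shows "norm_sq M (\<lambda>x. f x - g x)
     = norm_sq M f - 2 * Re (LINT x|M. f x * cnj (g x)) + norm_sq M g"
proof -
  have "(norm (f x - g x))\<^sup>2 = (norm (f x))\<^sup>2 - 2 * Re (f x * cnj (g x)) + (norm (g x))\<^sup>2" for x
    unfolding cmod_power2 by (simp add: power2_eq_square algebra_simps)
  then have "norm_sq M (\<lambda>x. f x - g x)
      = (LINT x|M. (norm (f x))\<^sup>2 - 2 * Re (f x * cnj (g x)) + (norm (g x))\<^sup>2)"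
    by (simp add: norm_sq_def)
  also have "\<dots> = norm_sq M f - 2 * (LINT x|M. Re (f x * cnj (g x))) + norm_sq M g"
    using f g sq_integrable_inner[OF f g] unfolding norm_sq_def sq_integrable_def
    by (simp add: integrable_Re del: times_complex.simps Re_complex_div_gt_0)
  also have "(LINT x|M. Re (f x * cnj (g x))) = Re (LINT x|M. f x * cnj (g x))"
    by (rule integral_Re[OF sq_integrable_inner[OF f g]])
  finally show ?thesis .
qed

text \<open>The form suited to minimizing sequences: a lower bound on the midpoint term limits how
  far apart two near-minimizers can be.\<close>

lemma parallelogram_midpoint:
  assumes u: "sq_integrable M u" and v: "sq_integrable M v"
  shows "norm_sq M (\<lambda>x. u x - v x)
     = 2 * norm_sq M u + 2 * norm_sq M v - 4 * norm_sq M (\<lambda>x. (u x + v x) / 2)"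
proof -
  have "(norm (u x - v x))\<^sup>2 = 2 * (norm (u x))\<^sup>2 + 2 * (norm (v x))\<^sup>2 - (norm (u x + v x))\<^sup>2" for x
    unfolding cmod_power2 by (simp add: power2_eq_square algebra_simps)
  then have "norm_sq M (\<lambda>x. u x - v x)
      = (LINT x|M. 2 * (norm (u x))\<^sup>2 + 2 * (norm (v x))\<^sup>2 - (norm (u x + v x))\<^sup>2)"
    by (simp add: norm_sq_def)
  also have "\<dots> = 2 * norm_sq M u + 2 * norm_sq M v - norm_sq M (\<lambda>x. u x + v x)"
    using u v sq_integrable_add[OF u v] unfolding norm_sq_def sq_integrable_def by simp
  also have "norm_sq M (\<lambda>x. u x + v x) = 4 * norm_sq M (\<lambda>x. (u x + v x) / 2)"
    using norm_sq_cmult[of M "1/2" "\<lambda>x. u x + v x"] by (simp add: power2_eq_square)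
  finally show ?thesis .
qed

text \<open>First variation: moving \<open>f\<close> along a small multiple of \<open>k\<close> in
  the direction of the inner product \<open>I\<close> lowers the squared norm by
  \<open>2 * t * (norm I)^2\<close> to first order, and for small \<open>t\<close> the quadratic
  term cannot make up for it.\<close>

lemma orthogonal_of_minimal:
  assumes f: "sq_integrable M f" and k: "sq_integrable M k"
    and min: "\<And>c. norm_sq M f \<le> norm_sq M (\<lambda>x. f x - c * k x)"
  shows "(LINT x|M. f x * cnj (k x)) = 0"
proof (rule ccontr)
  define I where "I = (LINT x|M. f x * cnj (k x))"
  assume "(LINT x|M. f x * cnj (k x)) \<noteq> 0"
  then have pos: "0 < (norm I)\<^sup>2" by (simp add: I_def)
  \<comment> \<open>Chosen so that \<open>t * norm_sq M k < 1\<close>; the added 1 keeps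
    \<open>t\<close> defined when \<open>norm_sq M k = 0\<close>.\<close>
  define t where "t = 1 / (1 + norm_sq M k)"
  have nk: "0 \<le> norm_sq M k" by (rule norm_sq_nonneg)
  then have t: "0 < t" "t * norm_sq M k < 1" by (auto simp: t_def)
  define c where "c = complex_of_real t * I"
  have "(LINT x|M. f x * cnj (c * k x)) = (LINT x|M. cnj c * (f x * cnj (k x)))"
    by (simp add: mult_ac)
  also have "\<dots> = cnj c * I" by (simp add: I_def)
  also have "Re \<dots> = t * (norm I)\<^sup>2"
    unfolding cmod_power2 by (simp add: c_def power2_eq_square algebra_simps)
  finally have "norm_sq M (\<lambda>x. f x - c * k x) = norm_sq M f - 2 * (t * (norm I)\<^sup>2) + (norm c)\<^sup>2 * norm_sq M k"
    by (simp add: norm_sq_diff[OF f sq_integrable_cmult[OF k]] norm_sq_cmult)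
  moreover have "(norm c)\<^sup>2 * norm_sq M k = (t * (norm I)\<^sup>2) * (t * norm_sq M k)"
    by (simp add: c_def norm_mult power_mult_distrib power2_eq_square)
  ultimately have "2 * (t * (norm I)\<^sup>2) \<le> (t * (norm I)\<^sup>2) * (t * norm_sq M k)"
    using min[of c] by linarith
  moreover have "(t * (norm I)\<^sup>2) * (t * norm_sq M k) < (t * (norm I)\<^sup>2) * 1"
    using t pos by (intro mult_strict_left_mono) auto
  moreover have "0 < t * (norm I)\<^sup>2" using t pos by simp
  ultimately show False by linarith
qed

text \<open>Completeness is only required inside \<open>V\<close>, so that limits may be taken pointwise.\<close>

lemma L2_projection_exists:
  assumes V: "\<And>f. f \<in> V \<Longrightarrow> sq_integrable M f"
    and zero: "(\<lambda>x. 0) \<in> V"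
    and add: "\<And>f h. f \<in> V \<Longrightarrow> h \<in> V \<Longrightarrow> (\<lambda>x. f x + h x) \<in> V"
    and cmult: "\<And>c f. f \<in> V \<Longrightarrow> (\<lambda>x. c * f x) \<in> V"
    and complete: "\<And>s. (\<And>n. s n \<in> V) \<Longrightarrow>
        (\<And>e. 0 < e \<Longrightarrow> \<exists>N. \<forall>m\<ge>N. \<forall>n\<ge>N. norm_sq M (\<lambda>x. s m x - s n x) < e) \<Longrightarrow>
        \<exists>f\<in>V. (\<lambda>n. norm_sq M (\<lambda>x. s n x - f x)) \<longlonglongrightarrow> 0"
    and g: "sq_integrable M g"
  shows "\<exists>f\<in>V. \<forall>k\<in>V. (LINT x|M. (g x - f x) * cnj (k x)) = 0"
proof -
  define d where "d = (INF h\<in>V. norm_sq M (\<lambda>x. g x - h x))"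
  have bdd: "bdd_below ((\<lambda>h. norm_sq M (\<lambda>x. g x - h x)) ` V)"
    by (rule bdd_belowI2[of _ 0]) (rule norm_sq_nonneg)
  have d_le: "d \<le> norm_sq M (\<lambda>x. g x - h x)" if "h \<in> V" for h
    unfolding d_def using bdd that by (rule cINF_lower)
  have "\<exists>h\<in>V. norm_sq M (\<lambda>x. g x - h x) < d + 1 / real (Suc n)" for n
  proof -
    have "(INF h\<in>V. norm_sq M (\<lambda>x. g x - h x)) < d + 1 / real (Suc n)"
      by (simp add: d_def)
    then show ?thesis
      using zero bdd by (subst (asm) cINF_less_iff) auto
  qed
  then obtain s where sV: "\<And>n. s n \<in> V"
    and s: "\<And>n. norm_sq M (\<lambda>x. g x - s n x) < d + 1 / real (Suc n)"
    by metis
  have gs: "sq_integrable M (\<lambda>x. g x - s n x)" for n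
    by (intro sq_integrable_diff g V sV)
  have "\<exists>N. \<forall>m\<ge>N. \<forall>n\<ge>N. norm_sq M (\<lambda>x. s m x - s n x) < e" if "0 < e" for e
  proof -
    \<comment> \<open>The midpoint of \<open>s m\<close> and \<open>s n\<close> lies in
      \<open>V\<close>, so its squared distance from \<open>g\<close> is at least \<open>d\<close>.
      In the parallelogram law the terms in \<open>d\<close> cancel, leaving less than
      \<open>4 / real (Suc N)\<close>.\<close>
    obtain N where N: "1 / real (Suc N) < e / 4"
      using nat_approx_posE[of "e / 4"] \<open>0 < e\<close> by auto
    have "norm_sq M (\<lambda>x. s m x - s n x) < e" if "N \<le> m" "N \<le> n" for m n
    proof -
      have "(\<lambda>x. (1/2) * (s m x + s n x)) \<in> V" by (intro cmult add sV)
      from d_le[OF this] have "d \<le> norm_sq M (\<lambda>x. ((g x - s m x) + (g x - s n x)) / 2)"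
        by (simp add: field_simps)
      moreover have "norm_sq M (\<lambda>x. s m x - s n x) = norm_sq M (\<lambda>x. (g x - s n x) - (g x - s m x))"
        by simp
      moreover have "1 / real (Suc m) \<le> 1 / real (Suc N)" "1 / real (Suc n) \<le> 1 / real (Suc N)"
        using that by (auto simp: field_simps)
      ultimately show ?thesis
        using parallelogram_midpoint[OF gs[of n] gs[of m]] s[of m] s[of n] N
        by (simp add: add.commute)
    qed
    then show ?thesis by blast
  qed
  from complete[OF sV this] obtain f where f: "f \<in> V"
    and lim: "(\<lambda>n. norm_sq M (\<lambda>x. s n x - f x)) \<longlonglongrightarrow> 0"
    by blast
  have gf: "sq_integrable M (\<lambda>x. g x - f x)" by (intro sq_integrable_diff g V f)
  \<comment> \<open>The weighted inequality bounds the distance to the limit by that to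
    \<open>s n\<close>. First \<open>n\<close> tends to infinity at fixed \<open>e\<close>, then
    \<open>e\<close> tends to 0 along \<open>1 / real (Suc n)\<close>.\<close>
  have le: "norm_sq M (\<lambda>x. g x - f x) \<le> (1 + e) * d" if "0 < e" for e
  proof (rule LIMSEQ_le_const)
    show "(\<lambda>n. (1 + e) * (d + 1 / real (Suc n)) + (1 + 1 / e) * norm_sq M (\<lambda>x. s n x - f x))
        \<longlonglongrightarrow> (1 + e) * d"
    proof -
      have "(\<lambda>n. (1 + e) * (d + 1 / real (Suc n)) + (1 + 1 / e) * norm_sq M (\<lambda>x. s n x - f x))
          \<longlonglongrightarrow> (1 + e) * (d + 0) + (1 + 1 / e) * 0"
        by (intro tendsto_intros lim LIMSEQ_Suc[OF lim_1_over_n])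
      then show ?thesis by simp
    qed
    have "norm_sq M (\<lambda>x. g x - f x)
        \<le> (1 + e) * (d + 1 / real (Suc n)) + (1 + 1 / e) * norm_sq M (\<lambda>x. s n x - f x)" for n
    proof -
      have "norm_sq M (\<lambda>x. (g x - s n x) + (s n x - f x))
          \<le> (1 + e) * norm_sq M (\<lambda>x. g x - s n x) + (1 + 1 / e) * norm_sq M (\<lambda>x. s n x - f x)"
        by (intro norm_sq_add_le gs sq_integrable_diff V sV f that)
      also have "\<dots> \<le> (1 + e) * (d + 1 / real (Suc n)) + (1 + 1 / e) * norm_sq M (\<lambda>x. s n x - f x)"
        using s[of n] that by (intro add_right_mono mult_left_mono) auto
      finally show ?thesis by simp
    qed
    then show "\<exists>N. \<forall>n\<ge>N. norm_sq M (\<lambda>x. g x - f x)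
        \<le> (1 + e) * (d + 1 / real (Suc n)) + (1 + 1 / e) * norm_sq M (\<lambda>x. s n x - f x)"
      by blast
  qed
  have min: "norm_sq M (\<lambda>x. g x - f x) \<le> d"
  proof (rule LIMSEQ_le_const)
    have "(\<lambda>n. (1 + 1 / real (Suc n)) * d) \<longlonglongrightarrow> (1 + 0) * d"
      by (intro tendsto_intros LIMSEQ_Suc[OF lim_1_over_n])
    then show "(\<lambda>n. (1 + 1 / real (Suc n)) * d) \<longlonglongrightarrow> d" by simp
    show "\<exists>N. \<forall>n\<ge>N. norm_sq M (\<lambda>x. g x - f x) \<le> (1 + 1 / real (Suc n)) * d"
      using le[of "1 / real (Suc n)" for n] by simp
  qed
  have "(LINT x|M. (g x - f x) * cnj (k x)) = 0" if "k \<in> V" for k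
  proof (rule orthogonal_of_minimal[OF gf V[OF that]])
    fix c
    have "(\<lambda>x. f x + c * k x) \<in> V" by (intro add cmult f that)
    from d_le[OF this] min show "norm_sq M (\<lambda>x. g x - f x) \<le> norm_sq M (\<lambda>x. (g x - f x) - c * k x)"
      by (simp add: algebra_simps)
  qed
  with f show ?thesis by blast
qed

text \<open>Fatou's lemma, run on nonnegative integrals so that square integrability of the limit
  comes out together with the bound.\<close>

lemma norm_sq_pointwise_limit:
  assumes u: "\<And>n. sq_integrable M (u n)"
    and lim: "\<And>x. x \<in> space M \<Longrightarrow> (\<lambda>n. u n x) \<longlonglongrightarrow> v x"
    and bound: "\<And>n. N \<le> n \<Longrightarrow> norm_sq M (u n) \<le> e"
  shows "sq_integrable M v" and "norm_sq M v \<le> e"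
proof -
  have [measurable]: "u n \<in> borel_measurable M" for n
    using u by (simp add: sq_integrable_def)
  have v[measurable]: "v \<in> borel_measurable M"
    by (rule borel_measurable_LIMSEQ_metric[OF _ lim]) auto
  \<comment> \<open>\<open>ennreal\<close> sends negative reals to 0, so this sign is needed to
    carry the final bound back to the reals.\<close>
  have "0 \<le> e" using bound[of N] norm_sq_nonneg[of M "u N"] by simp
  have nn: "(\<integral>\<^sup>+x. ennreal ((norm (u n x))\<^sup>2) \<partial>M) = ennreal (norm_sq M (u n))" for n
    unfolding norm_sq_def using u by (intro nn_integral_eq_integral) (auto simp: sq_integrable_def)
  have "(\<integral>\<^sup>+x. ennreal ((norm (v x))\<^sup>2) \<partial>M)
      = (\<integral>\<^sup>+x. liminf (\<lambda>n. ennreal ((norm (u n x))\<^sup>2)) \<partial>M)"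
  proof (rule nn_integral_cong)
    fix x assume "x \<in> space M"
    then have "(\<lambda>n. ennreal ((norm (u n x))\<^sup>2)) \<longlonglongrightarrow> ennreal ((norm (v x))\<^sup>2)"
      by (intro tendsto_ennrealI tendsto_intros lim)
    then show "ennreal ((norm (v x))\<^sup>2) = liminf (\<lambda>n. ennreal ((norm (u n x))\<^sup>2))"
      by (intro lim_imp_Liminf[symmetric]) auto
  qed
  also have "\<dots> \<le> liminf (\<lambda>n. \<integral>\<^sup>+x. ennreal ((norm (u n x))\<^sup>2) \<partial>M)"
    by (rule nn_integral_liminf) measurable
  also have "\<dots> \<le> limsup (\<lambda>n. \<integral>\<^sup>+x. ennreal ((norm (u n x))\<^sup>2) \<partial>M)"
    by (rule Liminf_le_Limsup) simp
  also have "\<dots> \<le> ennreal e"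
    by (rule Limsup_bounded)
       (use bound in \<open>auto simp: nn eventually_sequentially intro!: ennreal_leI exI[of _ N]\<close>)
  finally have le: "(\<integral>\<^sup>+x. ennreal ((norm (v x))\<^sup>2) \<partial>M) \<le> ennreal e" .
  then have "integrable M (\<lambda>x. (norm (v x))\<^sup>2)"
    by (intro integrableI_bounded) (auto simp: order_le_less_trans)
  then show "sq_integrable M v" by (simp add: sq_integrable_def)
  have "norm_sq M v = enn2real (\<integral>\<^sup>+x. ennreal ((norm (v x))\<^sup>2) \<partial>M)"
    unfolding norm_sq_def by (intro integral_eq_nn_integral) auto
  then show "norm_sq M v \<le> e"
    using enn2real_mono[OF le] \<open>0 \<le> e\<close> by simp
qed

section \<open>The spaces L^p and their inclusion in L^2\<close>

lemma Lp_space_2_iff: "f \<in> Lp_space 2 \<Omega> \<longleftrightarrow> sq_integrable (lebesgue_on \<Omega>) f"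
  by (simp add: Lp_space_def sq_integrable_def)

lemma Lp_norm_2_eq: "Lp_norm 2 \<Omega> f = sqrt (norm_sq (lebesgue_on \<Omega>) f)"
  unfolding Lp_norm_def norm_sq_def by (simp add: powr_half_sqrt)

text \<open>Only closure under sums is wanted, so the crude bound by \<open>2 powr p\<close> times
  the sum of the powers serves in place of Minkowski's inequality.\<close>

lemma Lp_space_add:
  assumes "0 \<le> p" and f: "f \<in> Lp_space p \<Omega>" and g: "g \<in> Lp_space p \<Omega>"
  shows "(\<lambda>z. f z + g z) \<in> Lp_space p \<Omega>"
proof -
  have [measurable]: "f \<in> borel_measurable (lebesgue_on \<Omega>)" "g \<in> borel_measurable (lebesgue_on \<Omega>)"
    using f g by (auto simp: Lp_space_def)
  have "norm (u + v) powr p \<le> 2 powr p * (norm u powr p + norm v powr p)" for u v :: complex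
  proof -
    have "norm (u + v) \<le> 2 * max (norm u) (norm v)"
      using norm_triangle_ineq[of u v] by linarith
    then have "norm (u + v) powr p \<le> (2 * max (norm u) (norm v)) powr p"
      using \<open>0 \<le> p\<close> by (intro powr_mono2) auto
    also have "\<dots> = 2 powr p * max (norm u) (norm v) powr p"
      by (simp add: powr_mult)
    also have "\<dots> \<le> 2 powr p * (norm u powr p + norm v powr p)"
      by (intro mult_left_mono) (auto simp: max_def)
    finally show ?thesis .
  qed
  then have le: "norm (norm (f z + g z) powr p)
      \<le> norm (2 powr p * (norm (f z) powr p + norm (g z) powr p))" for z
    by simp
  have "integrable (lebesgue_on \<Omega>) (\<lambda>z. norm (f z + g z) powr p)"
  proof (rule Bochner_Integration.integrable_bound)
    show "integrable (lebesgue_on \<Omega>) (\<lambda>z. 2 powr p * (norm (f z) powr p + norm (g z) powr p))"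
      using f g by (intro integrable_mult_right Bochner_Integration.integrable_add) (simp_all add: Lp_space_def)
  qed (measurable, rule AE_I2, rule le)
  then show ?thesis by (simp add: Lp_space_def)
qed

lemma Lp_space_cmult:
  assumes f: "f \<in> Lp_space p \<Omega>"
  shows "(\<lambda>z. c * f z) \<in> Lp_space p \<Omega>"
proof -
  have "f \<in> borel_measurable (lebesgue_on \<Omega>)" using f by (simp add: Lp_space_def)
  then have "(\<lambda>z. c * f z) \<in> borel_measurable (lebesgue_on \<Omega>)" by measurable
  then show ?thesis using f by (simp add: Lp_space_def norm_mult powr_mult)
qed

text \<open>Pointwise, the square is at most 1 plus the \<open>p\<close>-th power, and the constant
  1 is integrable for a finite measure.\<close>

lemma Lp_space_imp_sq_integrable:
  assumes "2 \<le> p" and fin: "finite_measure (lebesgue_on \<Omega>)" and f: "f \<in> Lp_space p \<Omega>"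
  shows "sq_integrable (lebesgue_on \<Omega>) f"
proof -
  interpret finite_measure "lebesgue_on \<Omega>" by (rule fin)
  have [measurable]: "f \<in> borel_measurable (lebesgue_on \<Omega>)"
    using f by (simp add: Lp_space_def)
  have "(norm u)\<^sup>2 \<le> 1 + norm u powr p" for u :: complex
  proof (cases "norm u \<le> 1")
    case True
    then show ?thesis by (simp add: add_increasing2 power_le_one)
  next
    case False
    then have "norm u powr 2 \<le> norm u powr p" using \<open>2 \<le> p\<close> by (intro powr_mono) auto
    then show ?thesis by simp
  qed
  then have le: "norm ((norm (f z))\<^sup>2) \<le> norm (1 + norm (f z) powr p)" for z
    by simp
  have "integrable (lebesgue_on \<Omega>) (\<lambda>z. (norm (f z))\<^sup>2)"
  proof (rule Bochner_Integration.integrable_bound)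
    show "integrable (lebesgue_on \<Omega>) (\<lambda>z. 1 + norm (f z) powr p)"
      using f by (intro Bochner_Integration.integrable_add) (simp_all add: Lp_space_def)
  qed (measurable, rule AE_I2, rule le)
  then show ?thesis by (simp add: sq_integrable_def)
qed

subsection \<open>Bergman spaces\<close>

text \<open>Point evaluation is bounded on A^2. The volume is taken of the ball about 0 to show that
  the constant depends only on \<open>r\<close>, which later gives uniformity in
  \<open>a\<close>.\<close>

lemma holomorphic_Cn_point_bound:
  fixes a :: "complex ^ 'n"
  assumes \<Omega>: "\<Omega> \<in> sets lebesgue" "ball a r \<subseteq> \<Omega>" and hol: "holomorphic_Cn f (ball a r)"
    and f: "sq_integrable (lebesgue_on \<Omega>) f"
  shows "(norm (f a))\<^sup>2 * measure lborel (ball (0 :: complex ^ 'n) r) \<le> norm_sq (lebesgue_on \<Omega>) f"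
proof -
  have "measure lborel (ball (0 :: complex ^ 'n) r) = measure lborel (ball a r)"
  proof (cases "0 \<le> r")
    case True
    then show ?thesis by (simp add: content_ball)
  next
    case False
    then have "ball a r = {}" "ball (0 :: complex ^ 'n) r = {}" by simp_all
    then show ?thesis by (simp only:)
  qed
  then have "ennreal ((norm (f a))\<^sup>2 * measure lborel (ball (0 :: complex ^ 'n) r))
      = ennreal ((norm (f a))\<^sup>2) * emeasure lborel (ball a r)"
    using emeasure_lborel_ball_finite[of a r]
    by (simp add: ennreal_mult' emeasure_eq_ennreal_measure)
  also have "\<dots> \<le> (\<integral>\<^sup>+z. indicator (ball a r) z * ennreal ((norm (f z))\<^sup>2) \<partial>lborel)"
    by (rule ball_sub_mean_value[OF hol])
  \<comment> \<open>The mean value inequality is over Borel measure and the L^2 norm over its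
    completion; nonnegative integrals agree for both.\<close>
  also have "\<dots> = (\<integral>\<^sup>+z. indicator (ball a r) z * ennreal ((norm (f z))\<^sup>2) \<partial>lebesgue)"
    by (rule nn_integral_completion[symmetric])
  also have "\<dots> \<le> (\<integral>\<^sup>+z. ennreal ((norm (f z))\<^sup>2) * indicator \<Omega> z \<partial>lebesgue)"
    using \<Omega>(2) by (intro nn_integral_mono) (auto simp: indicator_def)
  also have "\<dots> = (\<integral>\<^sup>+z. ennreal ((norm (f z))\<^sup>2) \<partial>lebesgue_on \<Omega>)"
    using \<Omega>(1) by (subst nn_integral_restrict_space) auto
  also have "\<dots> = ennreal (norm_sq (lebesgue_on \<Omega>) f)"
    unfolding norm_sq_def using f by (intro nn_integral_eq_integral) (auto simp: sq_integrable_def)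
  finally show ?thesis
    by (simp add: ennreal_le_iff norm_sq_nonneg)
qed

lemma bergman_space_2_iff:
  "f \<in> bergman_space 2 \<Omega> \<longleftrightarrow>
     holomorphic_Cn f \<Omega> \<and> sq_integrable (lebesgue_on \<Omega>) f \<and> (\<forall>z. z \<notin> \<Omega> \<longrightarrow> f z = 0)"
  by (auto simp: bergman_space_def Lp_space_2_iff)

lemma bergman_space_0: "(\<lambda>z. 0) \<in> bergman_space p \<Omega>"
  by (simp add: bergman_space_def holomorphic_Cn_0 Lp_space_def)

lemma bergman_space_add:
  "0 \<le> p \<Longrightarrow> f \<in> bergman_space p \<Omega> \<Longrightarrow> g \<in> bergman_space p \<Omega> \<Longrightarrow>
     (\<lambda>z. f z + g z) \<in> bergman_space p \<Omega>"
  by (simp add: bergman_space_def holomorphic_Cn_add Lp_space_add)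

lemma bergman_space_cmult:
  "f \<in> bergman_space p \<Omega> \<Longrightarrow> (\<lambda>z. c * f z) \<in> bergman_space p \<Omega>"
  by (simp add: bergman_space_def holomorphic_Cn_cmult Lp_space_cmult)

text \<open>On \<open>\<Omega>\<close> the point bound turns zero norm into pointwise equality;
  outside, both functions are 0 by the encoding. This is what lets \<open>THE\<close> single out a
  function rather than a class modulo null sets.\<close>

lemma bergman_space_eqI:
  assumes "open \<Omega>" and f: "f \<in> bergman_space 2 \<Omega>" and g: "g \<in> bergman_space 2 \<Omega>"
    and 0: "norm_sq (lebesgue_on \<Omega>) (\<lambda>z. f z - g z) = 0"
  shows "f = g"
proof
  fix a
  show "f a = g a"
  proof (cases "a \<in> \<Omega>")
    case True
    then obtain r where r: "0 < r" "ball a r \<subseteq> \<Omega>" using \<open>open \<Omega>\<close> openE by blast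
    have "(norm (f a - g a))\<^sup>2 * measure lborel (ball (0 :: complex ^ 'a) r) \<le> 0"
      using f g r(2) \<open>open \<Omega>\<close> holomorphic_Cn_point_bound[of \<Omega> a r "\<lambda>z. f z - g z"]
      by (auto simp: bergman_space_2_iff 0 intro: holomorphic_Cn_diff holomorphic_Cn_subset sq_integrable_diff)
    then show ?thesis
      using content_ball_pos[OF r(1), of "0 :: complex ^ 'a"] by (simp add: mult_le_0_iff)
  next
    case False
    then show ?thesis using f g by (simp add: bergman_space_2_iff)
  qed
qed

lemma bergman_space_2_complete:
  fixes \<Omega> :: "(complex ^ 'n) set"
  assumes "open \<Omega>" and s: "\<And>n. s n \<in> bergman_space 2 \<Omega>"
    and Cauchy: "\<And>e. 0 < e \<Longrightarrow>
      \<exists>N. \<forall>m\<ge>N. \<forall>n\<ge>N. norm_sq (lebesgue_on \<Omega>) (\<lambda>z. s m z - s n z) < e"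
  shows "\<exists>f\<in>bergman_space 2 \<Omega>. (\<lambda>n. norm_sq (lebesgue_on \<Omega>) (\<lambda>z. s n z - f z)) \<longlonglongrightarrow> 0"
proof -
  let ?M = "lebesgue_on \<Omega>"
  have \<Omega>[measurable]: "\<Omega> \<in> sets lebesgue" using \<open>open \<Omega>\<close> by simp
  have hol: "holomorphic_Cn (s n) \<Omega>" and sq: "sq_integrable ?M (s n)" for n
    using s by (auto simp: bergman_space_2_iff)
  \<comment> \<open>The Cauchy condition is uniform over all points that have a ball of the same
    radius \<open>r\<close> inside \<open>\<Omega>\<close>, because \<open>c\<close> depends on
    \<open>r\<close> alone.\<close>
  have unif: "\<exists>N. \<forall>m\<ge>N. \<forall>n\<ge>N. \<forall>x. ball x r \<subseteq> \<Omega> \<longrightarrow> norm (s m x - s n x) \<le> e"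
    if "0 < r" "0 < e" for r e
  proof -
    define c where "c = measure lborel (ball (0 :: complex ^ 'n) r)"
    have "0 < c" unfolding c_def using \<open>0 < r\<close> by (rule content_ball_pos)
    then have "0 < e\<^sup>2 * c" using \<open>0 < e\<close> by simp
    from Cauchy[OF this] obtain N where
      N: "\<And>m n. N \<le> m \<Longrightarrow> N \<le> n \<Longrightarrow> norm_sq ?M (\<lambda>z. s m z - s n z) < e\<^sup>2 * c"
      by blast
    have "norm (s m x - s n x) \<le> e" if "N \<le> m" "N \<le> n" "ball x r \<subseteq> \<Omega>" for m n x
    proof -
      have "(norm (s m x - s n x))\<^sup>2 * c \<le> norm_sq ?M (\<lambda>z. s m z - s n z)"
        unfolding c_def
        by (rule holomorphic_Cn_point_bound[OF \<Omega> that(3)])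
           (use hol sq that(3) in \<open>auto intro: holomorphic_Cn_diff holomorphic_Cn_subset sq_integrable_diff\<close>)
      also have "\<dots> < e\<^sup>2 * c" using N that by blast
      finally have "(norm (s m x - s n x))\<^sup>2 < e\<^sup>2" using \<open>0 < c\<close> by simp
      then show ?thesis using \<open>0 < e\<close> by (meson less_imp_le power2_less_imp_less)
    qed
    then show ?thesis by blast
  qed
  have "\<exists>l. (\<lambda>n. s n x) \<longlonglongrightarrow> l" if "x \<in> \<Omega>" for x
  proof -
    obtain r where r: "0 < r" "ball x r \<subseteq> \<Omega>" using \<open>open \<Omega>\<close> \<open>x \<in> \<Omega>\<close> openE by blast
    have "\<exists>N. \<forall>m\<ge>N. \<forall>n\<ge>N. norm (s m x - s n x) < e" if "0 < e" for e
    proof -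
      have "e / 2 < e" "0 < e / 2" using that by auto
      with unif[OF r(1), of "e / 2"] r(2) show ?thesis by (meson order_le_less_trans)
    qed
    then show ?thesis by (metis CauchyI Cauchy_convergent_iff convergent_def)
  qed
  then obtain l where l: "\<And>x. x \<in> \<Omega> \<Longrightarrow> (\<lambda>n. s n x) \<longlonglongrightarrow> l x" by metis
  define f where "f x = (if x \<in> \<Omega> then l x else 0)" for x
  have f: "(\<lambda>n. s n x) \<longlonglongrightarrow> f x" if "x \<in> \<Omega>" for x
    using l that by (simp add: f_def)
  have "holomorphic_Cn f \<Omega>"
    unfolding holomorphic_Cn_def
  proof
    fix a assume "a \<in> \<Omega>"
    then obtain r' where r': "0 < r'" "ball a r' \<subseteq> \<Omega>" using \<open>open \<Omega>\<close> openE by blast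
    \<comment> \<open>With a third of the radius, every point within \<open>2 * r\<close> of
      \<open>a\<close> still has a ball of radius \<open>r\<close> inside \<open>\<Omega>\<close>;
      the limit lemma asks for uniformity on the doubled ball.\<close>
    define r where "r = r' / 3"
    have r: "0 < r" "ball a (3 * r) \<subseteq> \<Omega>" using r' by (auto simp: r_def)
    have sub: "ball x r \<subseteq> \<Omega>" if "x \<in> ball a (2 * r)" for x
    proof
      fix y assume "y \<in> ball x r"
      then have "dist a y < 3 * r" using that dist_triangle[of a y x] by simp
      then show "y \<in> \<Omega>" using r(2) by auto
    qed
    have sub2: "ball a (2 * r) \<subseteq> \<Omega>"
      using r by (intro order_trans[OF subset_ball r(2)]) simp
    have "holomorphic_Cn f (ball a r)"
    proof (rule holomorphic_Cn_uniform_limit[OF _ r(1)])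
      show "holomorphic_Cn (s n) (ball a (2 * r))" for n
        using hol sub2 by (rule holomorphic_Cn_subset)
      show "(\<lambda>n. s n x) \<longlonglongrightarrow> f x" if "x \<in> ball a (2 * r)" for x
        using that sub2 by (intro f) auto
      show "\<exists>N. \<forall>m\<ge>N. \<forall>n\<ge>N. \<forall>x\<in>ball a (2 * r). norm (s m x - s n x) \<le> e" if "0 < e" for e
        using unif[OF r(1) that] sub by meson
    qed
    then show "\<exists>D. (f has_derivative D) (at a) \<and> (\<forall>c v. D (c *s v) = c * D v)"
      using r(1) by (simp add: holomorphic_Cn_def)
  qed
  \<comment> \<open>For fixed \<open>n\<close>, Fatou is applied to \<open>s n - s m\<close> as
    \<open>m\<close> tends to infinity. This also shows that \<open>s n - f\<close>, and hence
    \<open>f\<close>, is square integrable.\<close>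
  have lim: "\<exists>N. \<forall>n\<ge>N. sq_integrable ?M (\<lambda>z. s n z - f z) \<and> norm_sq ?M (\<lambda>z. s n z - f z) \<le> e"
    if "0 < e" for e
  proof -
    obtain N where
      N: "\<And>m n. N \<le> m \<Longrightarrow> N \<le> n \<Longrightarrow> norm_sq ?M (\<lambda>z. s m z - s n z) < e"
      using Cauchy[OF \<open>0 < e\<close>] by blast
    have "sq_integrable ?M (\<lambda>z. s n z - f z) \<and> norm_sq ?M (\<lambda>z. s n z - f z) \<le> e" if "N \<le> n" for n
    proof -
      have 1: "sq_integrable ?M (\<lambda>z. s n z - s m z)" for m by (intro sq_integrable_diff sq)
      have 2: "(\<lambda>m. s n x - s m x) \<longlonglongrightarrow> s n x - f x" if "x \<in> space ?M" for x
        using that by (intro tendsto_intros f) (simp add: space_restrict_space)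
      have 3: "norm_sq ?M (\<lambda>z. s n z - s m z) \<le> e" if "N \<le> m" for m
        using N[OF \<open>N \<le> n\<close> that] by simp
      show ?thesis
        using norm_sq_pointwise_limit[of ?M "\<lambda>m z. s n z - s m z" "\<lambda>z. s n z - f z" N e, OF 1 2 3]
        by blast
    qed
    then show ?thesis by blast
  qed
  obtain n where "sq_integrable ?M (\<lambda>z. s n z - f z)" using lim[of 1] by auto
  from sq_integrable_diff[OF sq[of n] this] have "sq_integrable ?M f" by simp
  with \<open>holomorphic_Cn f \<Omega>\<close> have "f \<in> bergman_space 2 \<Omega>"
    by (simp add: bergman_space_2_iff f_def)
  moreover have "(\<lambda>n. norm_sq ?M (\<lambda>z. s n z - f z)) \<longlonglongrightarrow> 0"
  proof (rule LIMSEQ_I)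
    fix e :: real assume "0 < e"
    with lim[of "e / 2"] show "\<exists>N. \<forall>n\<ge>N. norm (norm_sq ?M (\<lambda>z. s n z - f z) - 0) < e"
      by (force simp: norm_sq_nonneg)
  qed
  ultimately show ?thesis by blast
qed

section \<open>The closure of A^p in A^2 and the projection onto it\<close>

lemma G2_space_iff:
  "f \<in> G2_space p \<Omega> \<longleftrightarrow> f \<in> bergman_space 2 \<Omega> \<and>
     (\<forall>e>0. \<exists>h\<in>bergman_space p \<Omega>. norm_sq (lebesgue_on \<Omega>) (\<lambda>z. f z - h z) < e)"
proof -
  have "(\<forall>e>0. \<exists>h\<in>bergman_space p \<Omega>. sqrt (norm_sq (lebesgue_on \<Omega>) (\<lambda>z. f z - h z)) < e) \<longleftrightarrow>
      (\<forall>e>0. \<exists>h\<in>bergman_space p \<Omega>. norm_sq (lebesgue_on \<Omega>) (\<lambda>z. f z - h z) < e)" (is "?L \<longleftrightarrow> ?R")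
  proof
    assume ?L
    show ?R
    proof (intro allI impI)
      fix e :: real assume "0 < e"
      then have "0 < sqrt e" by simp
      with \<open>?L\<close> show "\<exists>h\<in>bergman_space p \<Omega>. norm_sq (lebesgue_on \<Omega>) (\<lambda>z. f z - h z) < e"
        by (meson real_sqrt_less_iff)
    qed
  next
    assume ?R
    show ?L
    proof (intro allI impI)
      fix e :: real assume "0 < e"
      then have "0 < e\<^sup>2" by simp
      with \<open>?R\<close> obtain h where "h \<in> bergman_space p \<Omega>" "norm_sq (lebesgue_on \<Omega>) (\<lambda>z. f z - h z) < e\<^sup>2"
        by blast
      then show "\<exists>h\<in>bergman_space p \<Omega>. sqrt (norm_sq (lebesgue_on \<Omega>) (\<lambda>z. f z - h z)) < e"
        using \<open>0 < e\<close> by (metis real_less_lsqrt real_sqrt_less_iff real_sqrt_unique less_imp_le)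
    qed
  qed
  then show ?thesis by (simp add: G2_space_def Lp_norm_2_eq)
qed

context
  fixes \<Omega> :: "(complex ^ 'n) set" and p :: real
  assumes \<Omega>: "open \<Omega>" "bounded \<Omega>" and p: "2 \<le> p"
begin

lemma finite_measure_lebesgue_on: "finite_measure (lebesgue_on \<Omega>)"
proof
  have "\<Omega> \<in> lmeasurable" using \<Omega> by (simp add: lmeasurable_open)
  then show "emeasure (lebesgue_on \<Omega>) (space (lebesgue_on \<Omega>)) \<noteq> \<infinity>"
    using \<Omega>(1) by (simp add: space_restrict_space emeasure_restrict_space fmeasurable_def less_top)
qed

lemma bergman_space_sq_integrable: "f \<in> bergman_space p \<Omega> \<Longrightarrow> sq_integrable (lebesgue_on \<Omega>) f"
  using Lp_space_imp_sq_integrable[OF p finite_measure_lebesgue_on] by (simp add: bergman_space_def)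

lemma bergman_space_subset_G2_space: "bergman_space p \<Omega> \<subseteq> G2_space p \<Omega>"
proof
  fix f assume f: "f \<in> bergman_space p \<Omega>"
  then have "f \<in> bergman_space 2 \<Omega>"
    using bergman_space_sq_integrable[OF f] by (auto simp: bergman_space_2_iff) (auto simp: bergman_space_def)
  moreover have "norm_sq (lebesgue_on \<Omega>) (\<lambda>z. f z - f z) = 0" by (simp add: norm_sq_def)
  ultimately show "f \<in> G2_space p \<Omega>" using f unfolding G2_space_iff by metis
qed

lemma G2_space_sq_integrable: "f \<in> G2_space p \<Omega> \<Longrightarrow> sq_integrable (lebesgue_on \<Omega>) f"
  by (simp add: G2_space_iff bergman_space_2_iff)

lemma G2_space_add:
  assumes f: "f \<in> G2_space p \<Omega>" and g: "g \<in> G2_space p \<Omega>"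
  shows "(\<lambda>z. f z + g z) \<in> G2_space p \<Omega>"
  unfolding G2_space_iff
proof (intro conjI allI impI)
  show "(\<lambda>z. f z + g z) \<in> bergman_space 2 \<Omega>"
    using f g by (intro bergman_space_add) (auto simp: G2_space_iff)
  fix e :: real assume "0 < e"
  \<comment> \<open>The weighted inequality with weight 1 doubles each of the two errors.\<close>
  then have "0 < e / 4" by simp
  obtain h k where hk: "h \<in> bergman_space p \<Omega>" "k \<in> bergman_space p \<Omega>"
    and lt: "norm_sq (lebesgue_on \<Omega>) (\<lambda>z. f z - h z) < e / 4"
      "norm_sq (lebesgue_on \<Omega>) (\<lambda>z. g z - k z) < e / 4"
    using f g \<open>0 < e / 4\<close> unfolding G2_space_iff by meson
  have "norm_sq (lebesgue_on \<Omega>) (\<lambda>z. (f z - h z) + (g z - k z))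
      \<le> (1 + 1) * norm_sq (lebesgue_on \<Omega>) (\<lambda>z. f z - h z)
        + (1 + 1 / 1) * norm_sq (lebesgue_on \<Omega>) (\<lambda>z. g z - k z)"
    using hk f g
    by (intro norm_sq_add_le sq_integrable_diff)
       (simp_all add: G2_space_sq_integrable bergman_space_sq_integrable)
  with lt have "norm_sq (lebesgue_on \<Omega>) (\<lambda>z. (f z + g z) - (h z + k z)) < e"
    by (simp add: algebra_simps)
  moreover have "(\<lambda>z. h z + k z) \<in> bergman_space p \<Omega>"
    using hk p by (intro bergman_space_add) auto
  ultimately show "\<exists>h\<in>bergman_space p \<Omega>. norm_sq (lebesgue_on \<Omega>) (\<lambda>z. (f z + g z) - h z) < e"
    by (intro bexI[of _ "\<lambda>z. h z + k z"])
qed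

lemma G2_space_cmult:
  assumes f: "f \<in> G2_space p \<Omega>"
  shows "(\<lambda>z. c * f z) \<in> G2_space p \<Omega>"
  unfolding G2_space_iff
proof (intro conjI allI impI)
  show "(\<lambda>z. c * f z) \<in> bergman_space 2 \<Omega>"
    using f by (intro bergman_space_cmult) (auto simp: G2_space_iff)
  fix e :: real assume "0 < e"
  \<comment> \<open>The summand 1 allows \<open>c = 0\<close> in the division.\<close>
  have pos: "0 < (norm c)\<^sup>2 + 1" by (simp add: add_nonneg_pos)
  then have "0 < e / ((norm c)\<^sup>2 + 1)" using \<open>0 < e\<close> by simp
  then obtain h where h: "h \<in> bergman_space p \<Omega>"
    "norm_sq (lebesgue_on \<Omega>) (\<lambda>z. f z - h z) < e / ((norm c)\<^sup>2 + 1)"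
    using f unfolding G2_space_iff by meson
  have "norm_sq (lebesgue_on \<Omega>) (\<lambda>z. c * f z - c * h z)
      = (norm c)\<^sup>2 * norm_sq (lebesgue_on \<Omega>) (\<lambda>z. f z - h z)"
    by (simp add: norm_sq_cmult flip: right_diff_distrib)
  also have "\<dots> \<le> ((norm c)\<^sup>2 + 1) * norm_sq (lebesgue_on \<Omega>) (\<lambda>z. f z - h z)"
    by (simp add: distrib_right norm_sq_nonneg)
  also have "\<dots> < e" using h(2) pos by (simp add: field_simps)
  finally show "\<exists>h\<in>bergman_space p \<Omega>. norm_sq (lebesgue_on \<Omega>) (\<lambda>z. c * f z - h z) < e"
    using bergman_space_cmult[OF h(1)] by (intro bexI[of _ "\<lambda>z. c * h z"])
qed

lemma G2_space_diff:
  "f \<in> G2_space p \<Omega> \<Longrightarrow> g \<in> G2_space p \<Omega> \<Longrightarrow> (\<lambda>z. f z - g z) \<in> G2_space p \<Omega>"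
  using G2_space_add[OF _ G2_space_cmult[of g "- 1"]] by simp

text \<open>A limit exists in A^2 by completeness and stays in the closure: a late member of the
  sequence approximates it, and an element of A^p approximates that member.\<close>

lemma G2_space_complete:
  assumes s: "\<And>n. s n \<in> G2_space p \<Omega>"
    and Cauchy: "\<And>e. 0 < e \<Longrightarrow>
      \<exists>N. \<forall>m\<ge>N. \<forall>n\<ge>N. norm_sq (lebesgue_on \<Omega>) (\<lambda>z. s m z - s n z) < e"
  shows "\<exists>f\<in>G2_space p \<Omega>. (\<lambda>n. norm_sq (lebesgue_on \<Omega>) (\<lambda>z. s n z - f z)) \<longlonglongrightarrow> 0"
proof -
  have s2: "s n \<in> bergman_space 2 \<Omega>" for n using s by (simp add: G2_space_iff)
  obtain f where f: "f \<in> bergman_space 2 \<Omega>"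
    and lim: "(\<lambda>n. norm_sq (lebesgue_on \<Omega>) (\<lambda>z. s n z - f z)) \<longlonglongrightarrow> 0"
    using bergman_space_2_complete[OF \<Omega>(1) s2 Cauchy] by blast
  have "f \<in> G2_space p \<Omega>"
    unfolding G2_space_iff
  proof (intro conjI allI impI f)
    fix e :: real assume "0 < e"
    then have "0 < e / 4" by simp
    have "\<forall>\<^sub>F n in sequentially. norm_sq (lebesgue_on \<Omega>) (\<lambda>z. s n z - f z) < e / 4"
      using lim \<open>0 < e / 4\<close> by (rule order_tendstoD)
    then obtain n where n: "norm_sq (lebesgue_on \<Omega>) (\<lambda>z. s n z - f z) < e / 4"
      using eventually_happens'[OF sequentially_bot] by blast
    obtain h where h: "h \<in> bergman_space p \<Omega>" "norm_sq (lebesgue_on \<Omega>) (\<lambda>z. s n z - h z) < e / 4"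
      using s[of n] \<open>0 < e / 4\<close> unfolding G2_space_iff by meson
    have "norm_sq (lebesgue_on \<Omega>) (\<lambda>z. (f z - s n z) + (s n z - h z))
        \<le> (1 + 1) * norm_sq (lebesgue_on \<Omega>) (\<lambda>z. f z - s n z)
          + (1 + 1 / 1) * norm_sq (lebesgue_on \<Omega>) (\<lambda>z. s n z - h z)"
      using h(1) f s2[of n]
      by (intro norm_sq_add_le sq_integrable_diff)
         (simp_all add: bergman_space_2_iff bergman_space_sq_integrable)
    with n h(2) have "norm_sq (lebesgue_on \<Omega>) (\<lambda>z. f z - h z) < e"
      by (simp add: norm_sq_minus_commute[of _ f "s n"])
    then show "\<exists>h\<in>bergman_space p \<Omega>. norm_sq (lebesgue_on \<Omega>) (\<lambda>z. f z - h z) < e"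
      using h(1) by (rule bexI)
  qed
  with lim show ?thesis by blast
qed

text \<open>The definite description has meaning only after existence and uniqueness. For
  uniqueness, the difference of two candidates is the difference of their residuals and lies in the
  space; both residuals are orthogonal to it, so it is orthogonal to itself.\<close>

lemma sub_bergman_projection:
  assumes g: "sq_integrable (lebesgue_on \<Omega>) g"
  shows "sub_bergman_projection p \<Omega> g \<in> G2_space p \<Omega>"
    and "k \<in> G2_space p \<Omega> \<Longrightarrow> L2_inner \<Omega> (\<lambda>z. g z - sub_bergman_projection p \<Omega> g z) k = 0"
proof -
  let ?P = "\<lambda>f. f \<in> G2_space p \<Omega> \<and> (\<forall>k\<in>G2_space p \<Omega>. L2_inner \<Omega> (\<lambda>z. g z - f z) k = 0)"
  have "\<exists>f\<in>G2_space p \<Omega>. \<forall>k\<in>G2_space p \<Omega>. (LINT z|lebesgue_on \<Omega>. (g z - f z) * cnj (k z)) = 0"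
  proof (rule L2_projection_exists[where M = "lebesgue_on \<Omega>" and V = "G2_space p \<Omega>" and g = g])
    show "(\<lambda>z. 0) \<in> G2_space p \<Omega>"
      using bergman_space_subset_G2_space bergman_space_0 by (rule subsetD)
    show "(\<lambda>z. f z + h z) \<in> G2_space p \<Omega>" if "f \<in> G2_space p \<Omega>" "h \<in> G2_space p \<Omega>" for f h
      using that by (rule G2_space_add)
    show "(\<lambda>z. c * f z) \<in> G2_space p \<Omega>" if "f \<in> G2_space p \<Omega>" for c f
      using that by (rule G2_space_cmult)
    show "\<exists>f\<in>G2_space p \<Omega>. (\<lambda>n. norm_sq (lebesgue_on \<Omega>) (\<lambda>z. s n z - f z)) \<longlonglongrightarrow> 0"
      if "\<And>n. s n \<in> G2_space p \<Omega>"
        and "\<And>e. 0 < e \<Longrightarrow> \<exists>N. \<forall>m\<ge>N. \<forall>n\<ge>N. norm_sq (lebesgue_on \<Omega>) (\<lambda>z. s m z - s n z) < e"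
      for s :: "nat \<Rightarrow> complex ^ 'n \<Rightarrow> complex"
      using that by (rule G2_space_complete)
  qed (simp_all add: G2_space_sq_integrable g)
  then obtain f where f: "?P f" by (auto simp: L2_inner_def)
  have "f' = f" if f': "?P f'" for f'
  proof (rule bergman_space_eqI[OF \<Omega>(1)])
    let ?k = "\<lambda>z. f' z - f z"
    have k: "?k \<in> G2_space p \<Omega>" using f f' by (blast intro: G2_space_diff)
    have int: "integrable (lebesgue_on \<Omega>) (\<lambda>z. (g z - h z) * cnj (?k z))" if "?P h" for h
      using that k by (intro sq_integrable_inner sq_integrable_diff g G2_space_sq_integrable) auto
    have "complex_of_real (norm_sq (lebesgue_on \<Omega>) ?k) = (LINT z|lebesgue_on \<Omega>. ?k z * cnj (?k z))"
      unfolding norm_sq_def complex_norm_square[symmetric] by (rule integral_complex_of_real[symmetric])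
    also have "\<dots> = (LINT z|lebesgue_on \<Omega>. (g z - f z) * cnj (?k z) - (g z - f' z) * cnj (?k z))"
      by (simp add: algebra_simps)
    also have "\<dots> = L2_inner \<Omega> (\<lambda>z. g z - f z) ?k - L2_inner \<Omega> (\<lambda>z. g z - f' z) ?k"
      unfolding L2_inner_def by (intro Bochner_Integration.integral_diff int f f')
    also have "\<dots> = 0" using f f' k by simp
    finally show "norm_sq (lebesgue_on \<Omega>) ?k = 0" by simp
  qed (use f f' in \<open>auto simp: G2_space_iff\<close>)
  with f have "?P (THE f. ?P f)" by (rule theI)
  then show "sub_bergman_projection p \<Omega> g \<in> G2_space p \<Omega>"
    and "k \<in> G2_space p \<Omega> \<Longrightarrow> L2_inner \<Omega> (\<lambda>z. g z - sub_bergman_projection p \<Omega> g z) k = 0"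
    unfolding sub_bergman_projection_def L2_orthogonal_projection_def by auto
qed

text \<open>The residual \<open>g - sub_bergman_projection p \<Omega> g\<close> is orthogonal to
  \<open>h - sub_bergman_projection p \<Omega> g\<close>, which lies in the space, so the cross term
  vanishes.\<close>

lemma sub_bergman_projection_pythagoras:
  assumes g: "sq_integrable (lebesgue_on \<Omega>) g" and h: "h \<in> G2_space p \<Omega>"
  shows "norm_sq (lebesgue_on \<Omega>) (\<lambda>z. g z - h z)
     = norm_sq (lebesgue_on \<Omega>) (\<lambda>z. g z - sub_bergman_projection p \<Omega> g z)
       + norm_sq (lebesgue_on \<Omega>) (\<lambda>z. h z - sub_bergman_projection p \<Omega> g z)"
proof -
  let ?f = "sub_bergman_projection p \<Omega> g"
  note f = sub_bergman_projection(1)[OF g]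
  have k: "(\<lambda>z. h z - ?f z) \<in> G2_space p \<Omega>" using h f by (rule G2_space_diff)
  have "norm_sq (lebesgue_on \<Omega>) (\<lambda>z. (g z - ?f z) - (h z - ?f z))
      = norm_sq (lebesgue_on \<Omega>) (\<lambda>z. g z - ?f z)
        - 2 * Re (L2_inner \<Omega> (\<lambda>z. g z - ?f z) (\<lambda>z. h z - ?f z))
        + norm_sq (lebesgue_on \<Omega>) (\<lambda>z. h z - ?f z)"
    unfolding L2_inner_def
    by (intro norm_sq_diff sq_integrable_diff G2_space_sq_integrable g f h)
  then show ?thesis using sub_bergman_projection(2)[OF g k] by simp
qed

text \<open>Pythagoras leaves the squared distance from \<open>h\<close> to the projection as the
  excess. It is nonnegative, and it vanishes only when the two functions coincide.\<close>

theorem sub_bergman_projection_best_approximation: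
  assumes g: "g \<in> Lp_space p \<Omega>" and h: "h \<in> G2_space p \<Omega>"
  shows "Lp_norm 2 \<Omega> (\<lambda>z. g z - sub_bergman_projection p \<Omega> g z) \<le> Lp_norm 2 \<Omega> (\<lambda>z. g z - h z)"
    and "Lp_norm 2 \<Omega> (\<lambda>z. g z - sub_bergman_projection p \<Omega> g z) = Lp_norm 2 \<Omega> (\<lambda>z. g z - h z)
      \<longleftrightarrow> h = sub_bergman_projection p \<Omega> g"
proof -
  have g2: "sq_integrable (lebesgue_on \<Omega>) g"
    using p finite_measure_lebesgue_on g by (rule Lp_space_imp_sq_integrable)
  note eq = sub_bergman_projection_pythagoras[OF g2 h]
  show "Lp_norm 2 \<Omega> (\<lambda>z. g z - sub_bergman_projection p \<Omega> g z) \<le> Lp_norm 2 \<Omega> (\<lambda>z. g z - h z)"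
    by (simp add: Lp_norm_2_eq eq norm_sq_nonneg)
  have "h = sub_bergman_projection p \<Omega> g"
    if "norm_sq (lebesgue_on \<Omega>) (\<lambda>z. h z - sub_bergman_projection p \<Omega> g z) = 0"
    using \<Omega>(1) _ _ that
    by (rule bergman_space_eqI) (use h sub_bergman_projection(1)[OF g2] in \<open>auto simp: G2_space_iff\<close>)
  then show "Lp_norm 2 \<Omega> (\<lambda>z. g z - sub_bergman_projection p \<Omega> g z) = Lp_norm 2 \<Omega> (\<lambda>z. g z - h z)
      \<longleftrightarrow> h = sub_bergman_projection p \<Omega> g"
    by (auto simp: Lp_norm_2_eq eq) (simp add: norm_sq_def)
qed

end

section \<open>Openness and boundedness of the Hartogs triangle, and the conclusion\<close>

lemma open_hartogs_triangle:
  assumes "0 < \<gamma>"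
  shows "open (hartogs_triangle \<gamma>)"
proof -
  \<comment> \<open>A positive exponent makes \<open>powr\<close> continuous at base 0, that is, at
    points with \<open>z $ 1 = 0\<close>.\<close>
  have "continuous_on UNIV (\<lambda>z :: complex ^ 2. norm (z $ 1) powr \<gamma>)"
    using assms by (intro continuous_on_powr'[OF _ continuous_on_const] continuous_intros) auto
  then show ?thesis
    unfolding hartogs_triangle_def
    by (intro open_Collect_conj open_Collect_less; (assumption | intro continuous_intros))
qed

lemma bounded_hartogs_triangle:
  assumes "0 < \<gamma>"
  shows "bounded (hartogs_triangle \<gamma>)"
proof (rule boundedI)
  fix z assume z: "z \<in> hartogs_triangle \<gamma>"
  have "norm (z $ 1) \<le> 1"
  proof (rule ccontr)
    assume "\<not> norm (z $ 1) \<le> 1"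
    then have "1 \<le> norm (z $ 1) powr \<gamma>" using assms by (intro ge_one_powr_ge_zero) auto
    with z show False by (simp add: hartogs_triangle_def)
  qed
  \<comment> \<open>The Euclidean norm is at most the sum of the two coordinate moduli, each at most
    1.\<close>
  then show "norm z \<le> 2"
    using z L2_set_le_sum[of UNIV "\<lambda>i. norm (z $ i)"]
    by (simp add: hartogs_triangle_def norm_vec_def UNIV_2)
qed

theorem proposition4p46:
  fixes m n :: nat and p :: real and g :: "complex ^ 2 \<Rightarrow> complex"
    and \<Omega> :: "(complex ^ 2) set"
  defines "\<Omega> \<equiv> hartogs_triangle (real m / real n)"
  assumes "m > 0" and "n > 0" and "gcd m n = 1"
    and "2 \<le> p"
    and "g \<in> Lp_space p \<Omega>"
  shows "\<forall>h \<in> bergman_space p \<Omega>.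
      Lp_norm 2 \<Omega> (\<lambda>z. g z - sub_bergman_projection p \<Omega> g z) \<le> Lp_norm 2 \<Omega> (\<lambda>z. g z - h z) \<and>
      (Lp_norm 2 \<Omega> (\<lambda>z. g z - sub_bergman_projection p \<Omega> g z) = Lp_norm 2 \<Omega> (\<lambda>z. g z - h z)
        \<longleftrightarrow> h = sub_bergman_projection p \<Omega> g)"
proof
  fix h assume h: "h \<in> bergman_space p \<Omega>"
  have \<Omega>: "open \<Omega>" "bounded \<Omega>"
    using assms(2,3) unfolding \<Omega>_def
    by (simp_all add: open_hartogs_triangle bounded_hartogs_triangle)
  \<comment> \<open>Best approximation is available for all elements of the closure, so it suffices
    to place \<open>h\<close> there.\<close>
  have "h \<in> G2_space p \<Omega>"
    using bergman_space_subset_G2_space[OF \<Omega> \<open>2 \<le> p\<close>] h by blast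
  then show "Lp_norm 2 \<Omega> (\<lambda>z. g z - sub_bergman_projection p \<Omega> g z) \<le> Lp_norm 2 \<Omega> (\<lambda>z. g z - h z) \<and>
      (Lp_norm 2 \<Omega> (\<lambda>z. g z - sub_bergman_projection p \<Omega> g z) = Lp_norm 2 \<Omega> (\<lambda>z. g z - h z)
        \<longleftrightarrow> h = sub_bergman_projection p \<Omega> g)"
    using sub_bergman_projection_best_approximation[OF \<Omega> \<open>2 \<le> p\<close> \<open>g \<in> Lp_space p \<Omega>\<close>] by blast
qed

end
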